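(* Let $e,m$ be integers with $3\leq e<m$. If $m-e\leq 6$, then $\mathscr{R}(e,m)=\mathscr{C}(e,m)$.
   Context: A numerical monoid is an additive submonoid $\Gamma\subseteq\mathbb{N}$ (containing $0$) with $\mathbb{N}\setminus\Gamma$ finite. It has a unique minimal set of generators $g_0<g_1<\cdots<g_e$; its embedding dimension is $\mathrm{edim}(\Gamma)=e+1$ and its multiplicity is $\mathrm{mult}(\Gamma)=g_0$. Let $\varphi:\mathbb{N}^{e+1}\to\mathbb{N}$, $\varphi(a_0,\dots,a_e)=\sum_i a_ig_i$, and let $\ker\varphi=\{(\mathbf a,\mathbf b): \varphi(\mathbf a)=\varphi(\mathbf b)\}$ (a congruence on $\mathbb{N}^{e+1}$). The number of minimal relations $\rho(\Gamma)$ is the cardinality of a minimal generating set of the congruence $\ker\varphi$ (independent of the choice). Define $\mathscr{R}(e,m)=\max\{\rho(\Gamma): \mathrm{edim}(\Gamma)=e+1,\ \mathrm{mult}(\Gamma)=m\}$. For positive integers $n,d$ write the Macaulay expansion $n=\binom{n_d}{d}+\cdots+\binom{n_j}{j}$ with uniquely determined integers $n_d>n_{d-1}>\cdots>n_j\geq j\geq 1$, and set $n^{\langle d\rangle}=\binom{n_d+1}{d+1}+\cdots+\binom{n_j+1}{j+1}$; set $0^{\langle d\rangle}=0$. For integers $1<e<m$, let $r$ be the unique integer with $\binom{e+r-1}{r-1}\leq m<\binom{e+r}{r}$, let $s=m-\binom{e+r-1}{r-1}$, and define $\mathscr{C}(e,m)=\binom{e+r-1}{r}+s^{\langle r\rangle}-s$.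 *)

theory Defs
  imports Complex_Main
begin

section \<open>Numerical monoids\<close>

definition add_submonoid :: "nat set \<Rightarrow> bool" where
  "add_submonoid S \<longleftrightarrow> 0 \<in> S \<and> (\<forall>x\<in>S. \<forall>y\<in>S. x + y \<in> S)"

definition numerical_monoid :: "nat set \<Rightarrow> bool" where
  "numerical_monoid \<Gamma> \<longleftrightarrow> add_submonoid \<Gamma> \<and> finite (UNIV - \<Gamma>)"

definition min_generating_set :: "nat set \<Rightarrow> nat set \<Rightarrow> bool" where
  "min_generating_set \<Gamma> A \<longleftrightarrow>
     add_submonoid hull A = \<Gamma> \<and> (\<forall>B. B \<subset> A \<longrightarrow> add_submonoid hull B \<noteq> \<Gamma>)"

definition min_gens :: "nat set \<Rightarrow> nat set" where
  "min_gens \<Gamma> = (THE A. min_generating_set \<Gamma> A)"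

definition edim :: "nat set \<Rightarrow> nat" where
  "edim \<Gamma> = card (min_gens \<Gamma>)"

definition mult :: "nat set \<Rightarrow> nat" where
  "mult \<Gamma> = Min (min_gens \<Gamma>)"

text \<open>The minimal generators in increasing order, \<open>gen \<Gamma> 0 < gen \<Gamma> 1 < \<dots>\<close>;
  meaningful for indices below \<open>edim \<Gamma>\<close>.\<close>

definition gen :: "nat set \<Rightarrow> nat \<Rightarrow> nat" where
  "gen \<Gamma> i = sorted_list_of_set (min_gens \<Gamma>) ! i"


section \<open>The kernel congruence and minimal relations\<close>

text \<open>The monoid \<open>\<nat>\<^sup>k\<close>: functions vanishing outside \<open>{..<k}\<close>, so that vectors have
  unique representatives, with pointwise addition.\<close>

definition nvecs :: "nat \<Rightarrow> (nat \<Rightarrow> nat) set" where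
  "nvecs k = {a. \<forall>i\<ge>k. a i = 0}"

definition monoid_congruence ::
    "nat \<Rightarrow> ((nat \<Rightarrow> nat) \<times> (nat \<Rightarrow> nat)) set \<Rightarrow> bool" where
  "monoid_congruence k R \<longleftrightarrow> equiv (nvecs k) R \<and>
     (\<forall>(a, b)\<in>R. \<forall>c\<in>nvecs k. ((\<lambda>i. a i + c i), (\<lambda>i. b i + c i)) \<in> R)"

definition phi :: "nat set \<Rightarrow> (nat \<Rightarrow> nat) \<Rightarrow> nat" where
  "phi \<Gamma> a = (\<Sum>i<edim \<Gamma>. a i * gen \<Gamma> i)"

definition ker_phi :: "nat set \<Rightarrow> ((nat \<Rightarrow> nat) \<times> (nat \<Rightarrow> nat)) set" where
  "ker_phi \<Gamma> = {(a, b). a \<in> nvecs (edim \<Gamma>) \<and> b \<in> nvecs (edim \<Gamma>) \<and> phi \<Gamma> a = phi \<Gamma> b}"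

text \<open>For \<open>X \<subseteq> nvecs k \<times> nvecs k\<close>, the set \<open>monoid_congruence k hull X\<close> is the congruence
  on \<open>\<nat>\<^sup>k\<close> generated by \<open>X\<close>; otherwise the hull is \<open>UNIV\<close>, which is never a kernel.
  Minimality is with respect to inclusion.\<close>

definition min_relations :: "nat set \<Rightarrow> ((nat \<Rightarrow> nat) \<times> (nat \<Rightarrow> nat)) set \<Rightarrow> bool" where
  "min_relations \<Gamma> X \<longleftrightarrow>
     monoid_congruence (edim \<Gamma>) hull X = ker_phi \<Gamma> \<and>
     (\<forall>Y. Y \<subset> X \<longrightarrow> monoid_congruence (edim \<Gamma>) hull Y \<noteq> ker_phi \<Gamma>)"

definition rho :: "nat set \<Rightarrow> nat" where
  "rho \<Gamma> = card (SOME X. min_relations \<Gamma> X)"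

definition max_rho :: "nat \<Rightarrow> nat \<Rightarrow> nat" where
  "max_rho e m = Max {rho \<Gamma> | \<Gamma>. numerical_monoid \<Gamma> \<and> edim \<Gamma> = e + 1 \<and> mult \<Gamma> = m}"


section \<open>Macaulay expansions\<close>

definition macaulay_expansion :: "nat \<Rightarrow> nat \<Rightarrow> nat \<Rightarrow> (nat \<Rightarrow> nat) \<Rightarrow> bool" where
  "macaulay_expansion n d j c \<longleftrightarrow>
     1 \<le> j \<and> j \<le> d \<and> j \<le> c j \<and> (\<forall>i\<in>{j..<d}. c i < c (Suc i)) \<and>
     n = (\<Sum>i=j..d. c i choose i)"

text \<open>The coefficients \<open>c i\<close> are determined only for \<open>i \<in> {j..d}\<close>, hence the description
  of the value rather than of \<open>c\<close>.\<close>

definition macaulay_up :: "nat \<Rightarrow> nat \<Rightarrow> nat" where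
  "macaulay_up n d = (if n = 0 then 0 else
     (THE v. \<exists>j c. macaulay_expansion n d j c \<and> v = (\<Sum>i=j..d. (c i + 1) choose (i + 1))))"

definition bound_index :: "nat \<Rightarrow> nat \<Rightarrow> nat" where
  "bound_index e m =
     (THE r. 1 \<le> r \<and> ((e + r - 1) choose (r - 1)) \<le> m \<and> m < ((e + r) choose r))"

text \<open>Neither subtraction truncates: \<open>s \<le> macaulay_up s r\<close> since
  \<open>n choose i \<le> (n + 1) choose (i + 1)\<close>.\<close>

definition macaulay_bound :: "nat \<Rightarrow> nat \<Rightarrow> nat" where
  "macaulay_bound e m =
     (let r = bound_index e m; s = m - ((e + r - 1) choose (r - 1))
      in ((e + r - 1) choose r) + macaulay_up s r - s)"

end

theory Submission
  imports Defs "HOL-Library.Multiset"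
begin

text \<open>Call two factorizations of the same element linked if they share a variable. A set of pairs
  generates the kernel congruence iff, together with the linked pairs, its equivalence closure is
  the whole kernel, so minimal generating sets are bases of a graphic matroid and Steinitz exchange
  applies.

  Upper bound: order factorizations lexicographically, the variable of the multiplicity first, and
  call the greatest one in each fibre standard. The minimal non-standard vectors give a generating
  set, and they are the minimal monomials outside an order ideal of at most \<open>m\<close> monomials in
  \<open>e\<close> variables which contains all the variables. As at most \<open>s = m - e - 1 \<le> 5\<close> monomials of
  the ideal have degree \<open>\<ge> 2\<close>, a small instance of Macaulay's theorem bounds their number.

  Lower bound: an explicit monoid with generators \<open>m, x, y, z, \<dots>\<close> whose Apery set contains just
  the first \<open>s\<close> of \<open>2x, x + y, 2y, x + z, 2z\<close> besides \<open>0\<close> and generators, each factoring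
  uniquely. Then every other quadratic monomial, and every cubic monomial whose quadratic divisors
  are all of this form, is linked only to itself and forces a relation of its own.\<close>

section \<open>Independence modulo an equivalence relation\<close>

text \<open>Since \<open>rho\<close> selects its generating set by \<open>SOME\<close>, both bounds
  have to hold for every minimal set, and infinite ones have to be excluded. All estimates carry
  \<open>+ s\<close> on the left, which avoids truncated subtraction. For the upper bound the
  obstacle is that corners can have any degree; it is met because at most two monomials of the ideal
  are cubic, and two monomials or fewer cannot grow in number from there on. For the lower bound
  \<open>x\<close>, \<open>y\<close>, \<open>z\<close> get the residues 2, 3, -1 modulo
  \<open>m\<close>: the five sums then have residues 4, 5, 6, 1, -2, and in the tightest case
  \<open>s = 5\<close>, \<open>m = 9\<close> every residue is used exactly once. The sum
  \<open>y + z\<close> is avoided because it has the residue of \<open>x\<close>. The multiples of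
  \<open>m\<close> are layered: generators other than \<open>m\<close> lie between
  \<open>3 * m\<close> and \<open>6 * m\<close>, so no two of them add up to a third; those other
  than \<open>x\<close>, \<open>y\<close>, \<open>z\<close> lie above \<open>5 * m\<close>, so
  adding one of these to another overshoots the largest sum
  \<open>2 * z = 8 * m - 2\<close>.\<close>

definition eq_closure :: "'a rel \<Rightarrow> 'a rel \<Rightarrow> 'a rel" where
  "eq_closure D X = (D \<union> X \<union> X\<inverse>)\<^sup>*"

lemma eq_closure_superset: "D \<subseteq> eq_closure D X" "X \<subseteq> eq_closure D X"
  unfolding eq_closure_def by auto

lemma eq_closure_mono: "X \<subseteq> Y \<Longrightarrow> eq_closure D X \<subseteq> eq_closure D Y"
  unfolding eq_closure_def by (intro rtrancl_mono) auto

lemma sym_eq_closure: "sym D \<Longrightarrow> sym (eq_closure D X)"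
  unfolding eq_closure_def by (intro sym_rtrancl) (auto simp: sym_def)

lemma trans_eq_closure: "trans (eq_closure D X)"
  unfolding eq_closure_def by (rule trans_rtrancl)

lemma eq_closure_refl: "(a, a) \<in> eq_closure D X"
  unfolding eq_closure_def by simp

lemma eq_closure_least:
  assumes "sym D" and "Z \<subseteq> eq_closure D X"
  shows "eq_closure D Z \<subseteq> eq_closure D X"
proof -
  have "Z\<inverse> \<subseteq> eq_closure D X"
    using assms sym_eq_closure[OF assms(1)] by (auto dest: symD)
  then have "D \<union> Z \<union> Z\<inverse> \<subseteq> eq_closure D X"
    using assms eq_closure_superset(1) by blast
  then have "eq_closure D Z \<subseteq> (eq_closure D X)\<^sup>*"
    unfolding eq_closure_def[of D Z] by (rule rtrancl_mono)
  then show ?thesis by (simp add: eq_closure_def)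
qed

text \<open>A path that crosses the new edge several times can be cut down to at most one crossing;
  the last two alternatives are the two directions of that crossing.\<close>

lemma eq_closure_insertE:
  assumes D: "sym D" and uv: "(u, v) \<in> eq_closure D (insert (a, b) S)"
  shows "(u, v) \<in> eq_closure D S \<or>
    (u, a) \<in> eq_closure D S \<and> (b, v) \<in> eq_closure D S \<or>
    (u, b) \<in> eq_closure D S \<and> (a, v) \<in> eq_closure D S"
  using uv unfolding eq_closure_def[of D "insert (a, b) S"]
proof (induction rule: rtrancl_induct)
  case base
  show ?case by (simp add: eq_closure_refl)
next
  case (step v w)
  note sy = symD[OF sym_eq_closure[OF D, of S]] and tr = transD[OF trans_eq_closure[of D S]]
  from step.hyps consider "(v, w) \<in> eq_closure D S" | "v = a" "w = b" | "v = b" "w = a"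
    unfolding eq_closure_def by auto
  then show ?case
  proof cases
    case 1
    then show ?thesis using step.IH tr by blast
  next
    case 2
    then show ?thesis using step.IH sy tr eq_closure_refl[of _ D S] by blast
  next
    case 3
    then show ?thesis using step.IH sy tr eq_closure_refl[of _ D S] by blast
  qed
qed

text \<open>The path witnessing \<open>y\<close> must cross \<open>x\<close>; with \<open>y\<close>
  as an edge, its two remaining pieces close up to a path joining the ends of
  \<open>x\<close>.\<close>

lemma eq_closure_exchange:
  assumes D: "sym D" and "y \<in> eq_closure D (insert x S)" and "y \<notin> eq_closure D S"
  shows "x \<in> eq_closure D (insert y S)"
proof -
  obtain a b u v where xy: "x = (a, b)" "y = (u, v)" by (metis surj_pair)
  let ?E = "eq_closure D (insert y S)"
  note sy = symD[OF sym_eq_closure[OF D, of "insert y S"]]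
    and tr = transD[OF trans_eq_closure[of D "insert y S"]]
  have uv: "(u, v) \<in> ?E" using eq_closure_superset(2)[of "insert y S" D] xy by auto
  have sub: "p \<in> ?E" if "p \<in> eq_closure D S" for p
    using that eq_closure_mono[of S "insert y S" D] by auto
  have "(u, a) \<in> eq_closure D S \<and> (b, v) \<in> eq_closure D S \<or>
      (u, b) \<in> eq_closure D S \<and> (a, v) \<in> eq_closure D S"
    using eq_closure_insertE[OF D, of u v a b S] assms(2,3) xy by blast
  then show ?thesis
  proof (elim disjE conjE)
    assume "(u, a) \<in> eq_closure D S" "(b, v) \<in> eq_closure D S"
    then have "(a, u) \<in> ?E" "(v, b) \<in> ?E" using sub sy by auto
    then show ?thesis using uv tr xy by blast
  next
    assume "(u, b) \<in> eq_closure D S" "(a, v) \<in> eq_closure D S"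
    then have "(a, v) \<in> ?E" "(v, u) \<in> ?E" "(u, b) \<in> ?E" using sub sy uv by auto
    then show ?thesis using tr xy by blast
  qed
qed

text \<open>Steinitz: each round trades an element of \<open>X - Y\<close> for one of
  \<open>Y - X\<close>, keeping the size and the old \<open>X\<close> in the closure, so
  \<open>card (Y - X)\<close> drops.\<close>

lemma eq_closure_independent_le:
  assumes D: "sym D" and "finite X" "finite Y"
    and ind: "\<And>y. y \<in> Y \<Longrightarrow> y \<notin> eq_closure D (Y - {y})"
    and "Y \<subseteq> eq_closure D X"
  shows "card Y \<le> card X"
  using assms(2,5)
proof (induction "card (Y - X)" arbitrary: X rule: less_induct)
  case less
  show ?case
  proof (cases "Y \<subseteq> X")
    case True
    then show ?thesis using less.prems by (simp add: card_mono)
  next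
    case False
    then obtain y where y: "y \<in> Y" "y \<notin> X" by blast
    \<comment> \<open>Enlarge \<open>X \<inter> Y\<close> to \<open>X\<close> one element at a time:
      by independence \<open>y\<close> is outside the closure at the start, it is inside at the end,
      and \<open>x\<close> is the element that brings it in.\<close>
    have "\<exists>S x. x \<in> X - Y \<and> S \<subseteq> X \<and> x \<notin> S \<and> y \<in> eq_closure D (insert x S) \<and> y \<notin> eq_closure D S"
    proof (rule ccontr)
      assume no: "\<not> ?thesis"
      have "y \<notin> eq_closure D (X \<inter> Y \<union> T)" if "finite T" "T \<subseteq> X - Y" for T
        using that
      proof (induction T rule: finite_induct)
        case empty
        then show ?case
          using ind[OF y(1)] eq_closure_mono[of "X \<inter> Y" "Y - {y}" D] y by auto
      next
        case (insert t T)
        then have "y \<notin> eq_closure D (X \<inter> Y \<union> T)" "t \<in> X - Y" "t \<notin> X \<inter> Y \<union> T" "X \<inter> Y \<union> T \<subseteq> X"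
          by auto
        then have "y \<notin> eq_closure D (insert t (X \<inter> Y \<union> T))"
          using no by blast
        then show ?case by simp
      qed
      from this[of "X - Y"] have "y \<notin> eq_closure D X"
        using less.prems by (simp add: Int_Diff_Un)
      then show False using y less.prems by auto
    qed
    then obtain S x where Sx: "x \<in> X - Y" "S \<subseteq> X" "x \<notin> S"
      "y \<in> eq_closure D (insert x S)" "y \<notin> eq_closure D S" by blast
    let ?X = "insert y (X - {x})"
    have "x \<in> eq_closure D (insert y S)"
      using eq_closure_exchange[OF D Sx(4,5)] .
    then have "x \<in> eq_closure D ?X"
      using eq_closure_mono[of "insert y S" ?X D] Sx by blast
    then have "X \<subseteq> eq_closure D ?X"
      using eq_closure_superset(2)[of ?X D] by blast
    then have "Y \<subseteq> eq_closure D ?X"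
      using eq_closure_least[OF D] less.prems by blast
    moreover have "card (Y - ?X) < card (Y - X)"
      using y Sx(1) by (intro psubset_card_mono) (auto simp: \<open>finite Y\<close>)
    ultimately have "card Y \<le> card ?X"
      using less by simp
    also have "card ?X = card X"
      using y Sx(1) less.prems card_Suc_Diff1[of X x] by simp
    finally show ?thesis .
  qed
qed

section \<open>Relations among positive weights\<close>

definition lex_less :: "(nat \<Rightarrow> nat) \<Rightarrow> (nat \<Rightarrow> nat) \<Rightarrow> bool" where
  "lex_less a b \<longleftrightarrow> (\<exists>i. a i < b i \<and> (\<forall>j<i. a j = b j))"

lemma lex_less_irrefl: "\<not> lex_less a a"
  by (simp add: lex_less_def)

lemma lex_less_trans: "lex_less a b \<Longrightarrow> lex_less b c \<Longrightarrow> lex_less a c"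
  unfolding lex_less_def
proof (elim exE conjE)
  fix i j assume "a i < b i" "\<forall>l<i. a l = b l" "b j < c j" "\<forall>l<j. b l = c l"
  then show "\<exists>i. a i < c i \<and> (\<forall>j<i. a j = c j)"
    by (intro exI[of _ "min i j"]) (cases i j rule: linorder_cases, auto)
qed

lemma lex_less_total: "a \<noteq> b \<Longrightarrow> lex_less a b \<or> lex_less b a"
proof -
  assume "a \<noteq> b"
  then have ex: "\<exists>i. a i \<noteq> b i" by auto
  define i where "i = (LEAST i. a i \<noteq> b i)"
  have "a i \<noteq> b i" unfolding i_def using ex by (rule LeastI_ex)
  moreover have "\<forall>j<i. a j = b j" unfolding i_def using not_less_Least by blast
  ultimately show ?thesis unfolding lex_less_def by (metis linorder_neqE_nat)
qed

lemma lex_less_add_iff: "lex_less (\<lambda>i. a i + c i) (\<lambda>i. b i + c i) \<longleftrightarrow> lex_less a b"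
  by (simp add: lex_less_def)

lemma lex_less_0: "lex_less a b \<Longrightarrow> a 0 \<le> b 0"
  unfolding lex_less_def by (metis gr0I less_imp_le_nat order_refl)

definition unit_vec :: "nat \<Rightarrow> nat \<Rightarrow> nat" where
  "unit_vec i = (\<lambda>j. if j = i then 1 else 0)"

lemma unit_vec_simps [simp]: "unit_vec i i = 1" "i \<noteq> j \<Longrightarrow> unit_vec i j = 0"
  by (auto simp: unit_vec_def)

text \<open>The hull is the intersection of all congruences above \<open>X\<close>. The assumption
  excludes the empty intersection, which is \<open>UNIV\<close> and no congruence on
  \<open>nvecs k\<close>.\<close>

lemma monoid_congruence_hull: "\<exists>T. monoid_congruence k T \<and> X \<subseteq> T \<Longrightarrow> monoid_congruence k (monoid_congruence k hull X)"
proof -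
  assume ex: "\<exists>T. monoid_congruence k T \<and> X \<subseteq> T"
  let ?F = "{T. monoid_congruence k T \<and> X \<subseteq> T}"
  have F: "sym T" "trans T" "refl_on (nvecs k) T" "T \<subseteq> nvecs k \<times> nvecs k" if "T \<in> ?F" for T
    using that by (auto simp: monoid_congruence_def equiv_def)
  have "equiv (nvecs k) (\<Inter>?F)"
  proof (rule equivI)
    show "\<Inter>?F \<subseteq> nvecs k \<times> nvecs k" using ex F(4) by blast
    show "refl_on (nvecs k) (\<Inter>?F)" using F(3) unfolding refl_on_def by (intro ballI InterI) blast
    show "sym (\<Inter>?F)" using F(1) by (intro symI InterI) (meson InterD symD)
    show "trans (\<Inter>?F)" using F(2) by (intro transI InterI) (meson InterD transD)
  qed
  moreover have "((\<lambda>i. a i + c i), (\<lambda>i. b i + c i)) \<in> \<Inter>?F"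
    if "(a, b) \<in> \<Inter>?F" "c \<in> nvecs k" for a b c
  proof
    fix T assume T: "T \<in> ?F"
    then have "(a, b) \<in> T" using that by blast
    then show "((\<lambda>i. a i + c i), (\<lambda>i. b i + c i)) \<in> T"
      using T that(2) unfolding monoid_congruence_def by blast
  qed
  ultimately show ?thesis
    unfolding hull_def monoid_congruence_def[of k "\<Inter>?F"] by (intro conjI) auto
qed

section \<open>The kernel congruence and linked pairs\<close>

locale positive_weights =
  fixes k :: nat and g :: "nat \<Rightarrow> nat"
  assumes weight_pos: "i < k \<Longrightarrow> 0 < g i"
begin

definition deg :: "(nat \<Rightarrow> nat) \<Rightarrow> nat" where
  "deg a = (\<Sum>i<k. a i * g i)"

definition kernel :: "(nat \<Rightarrow> nat) rel" where
  "kernel = {(a, b). a \<in> nvecs k \<and> b \<in> nvecs k \<and> deg a = deg b}"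

definition linked :: "(nat \<Rightarrow> nat) rel" where
  "linked = {(a, b) \<in> kernel. \<exists>i. 0 < a i \<and> 0 < b i}"

lemma deg_add: "deg (\<lambda>i. a i + b i) = deg a + deg b"
  by (simp add: deg_def sum.distrib algebra_simps)

lemma deg_unit_vec: "i < k \<Longrightarrow> deg (unit_vec i) = g i"
  unfolding deg_def unit_vec_def
  by (subst sum.cong[OF refl, of _ _ "\<lambda>j. if j = i then g j else 0"]) auto

lemma unit_vec_nvecs: "i < k \<Longrightarrow> unit_vec i \<in> nvecs k"
  by (auto simp: unit_vec_def nvecs_def)

lemma add_nvecs: "a \<in> nvecs k \<Longrightarrow> b \<in> nvecs k \<Longrightarrow> (\<lambda>i. a i + b i) \<in> nvecs k"
  by (simp add: nvecs_def)

lemma nvecs_support: "a \<in> nvecs k \<Longrightarrow> 0 < a i \<Longrightarrow> i < k"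
  unfolding nvecs_def by (metis (mono_tags, lifting) gr_implies_not0 linorder_not_le mem_Collect_eq)

lemma decrement_nvecs: "a \<in> nvecs k \<Longrightarrow> a(i := a i - 1) \<in> nvecs k"
  by (auto simp: nvecs_def)

lemma decrement_add: "0 < a i \<Longrightarrow> (\<lambda>j. (a(i := a i - 1)) j + unit_vec i j) = a"
  by (auto simp: unit_vec_def)

lemma deg_decrement: "a \<in> nvecs k \<Longrightarrow> 0 < a i \<Longrightarrow> deg a = deg (a(i := a i - 1)) + g i"
  using deg_add[of "a(i := a i - 1)" "unit_vec i"] decrement_add[of a i]
    nvecs_support[of a i] deg_unit_vec[of i] by simp

lemma deg_ge_coord: "a \<in> nvecs k \<Longrightarrow> a i \<le> deg a"
proof (cases "i < k")
  case True
  then have "a i * g i \<le> deg a"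
    unfolding deg_def by (intro member_le_sum) auto
  moreover have "a i * 1 \<le> a i * g i" using weight_pos[OF True] by (intro mult_le_mono2) simp
  ultimately show ?thesis by linarith
qed (simp add: nvecs_def)

lemma finite_fiber: "finite {a \<in> nvecs k. deg a = n}"
proof (rule finite_subset)
  show "{a \<in> nvecs k. deg a = n} \<subseteq>
      {a. \<forall>i. (i \<in> {..<k} \<longrightarrow> a i \<in> {..n}) \<and> (i \<notin> {..<k} \<longrightarrow> a i = 0)}"
    using deg_ge_coord by (auto simp: nvecs_def)
qed (intro finite_set_of_finite_funs; simp)

lemma monoid_congruence_kernel: "monoid_congruence k kernel"
  unfolding monoid_congruence_def kernel_def
  by (auto intro!: equivI simp: refl_on_def sym_def trans_def add_nvecs deg_add)

lemma sym_linked: "sym linked"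
  by (auto simp: linked_def kernel_def sym_def)

lemma kernel_sym: "(a, b) \<in> kernel \<Longrightarrow> (b, a) \<in> kernel"
  by (auto simp: kernel_def)

text \<open>Translating a relation by a nonzero vector makes its two sides share a variable, so modulo
  linked pairs a generating set only has to connect, no longer to respect addition.\<close>

lemma hull_eq_kernel_iff:
  assumes X: "X \<subseteq> kernel"
  shows "monoid_congruence k hull X = kernel \<longleftrightarrow> kernel \<subseteq> eq_closure linked X"
proof
  assume hull: "monoid_congruence k hull X = kernel"
  \<comment> \<open>The closure is reflexive on the whole type, while a congruence lives on
    \<open>nvecs k\<close>; hence the intersection.\<close>
  let ?R = "eq_closure linked X \<inter> kernel"
  have "monoid_congruence k ?R"
    unfolding monoid_congruence_def
  proof (intro conjI ballI)
    have "sym ?R" using sym_eq_closure[OF sym_linked] kernel_sym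
      by (auto simp: sym_def)
    moreover have "trans ?R" 
      using trans_eq_closure[of linked X] by (auto simp: trans_def kernel_def)
    ultimately show "equiv (nvecs k) ?R"
      by (intro equivI) (auto simp: kernel_def refl_on_def eq_closure_refl)
  next
    fix p assume p: "p \<in> ?R"
    have "((\<lambda>i. a i + c i), (\<lambda>i. b i + c i)) \<in> ?R" if c: "c \<in> nvecs k" and ab: "p = (a, b)" for a b c
    proof (cases "\<exists>i. 0 < c i")
      case True
      have "((\<lambda>i. a i + c i), (\<lambda>i. b i + c i)) \<in> kernel"
        using p c ab by (auto simp: kernel_def add_nvecs deg_add)
      with True have "((\<lambda>i. a i + c i), (\<lambda>i. b i + c i)) \<in> linked"
        by (auto simp: linked_def)
      then show ?thesis using eq_closure_superset(1)[of linked X] by (auto simp: linked_def)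
    next
      case False
      then show ?thesis using p ab by auto
    qed
    then show "case p of (a, b) \<Rightarrow> \<forall>c\<in>nvecs k. ((\<lambda>i. a i + c i), (\<lambda>i. b i + c i)) \<in> ?R"
      by auto
  qed
  then have "monoid_congruence k hull X \<subseteq> ?R"
    using X eq_closure_superset(2)[of X linked] by (intro hull_minimal) auto
  then show "kernel \<subseteq> eq_closure linked X" using hull by auto
next
  assume gen: "kernel \<subseteq> eq_closure linked X"
  let ?R = "monoid_congruence k hull X"
  have R: "monoid_congruence k ?R"
    using X monoid_congruence_kernel by (intro monoid_congruence_hull) auto
  then have eqR: "equiv (nvecs k) ?R" unfolding monoid_congruence_def by simp
  have XR: "X \<subseteq> ?R" by (rule hull_subset)
  \<comment> \<open>Induction on the degree: a linked pair is the translate by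
    \<open>unit_vec i\<close> of a pair of smaller degree, so it lies in the hull without a
    generator of its own. The inner induction follows the path.\<close>
  have "(a, b) \<in> ?R" if "(a, b) \<in> kernel" "deg a = n" for a b n
    using that
  proof (induction n arbitrary: a b rule: less_induct)
    case (less n)
    have "(a, b) \<in> (linked \<union> X \<union> X\<inverse>)\<^sup>*"
      using less.prems gen by (auto simp: eq_closure_def)
    then show ?case
    proof (induction rule: rtrancl_induct)
      case base
      show ?case using eqR less.prems by (auto simp: equiv_def refl_on_def kernel_def)
    next
      case (step u v)
      have uv: "(u, v) \<in> kernel" 
        using step.hyps(2) X kernel_sym by (auto simp: linked_def)
      have "(a, u) \<in> kernel"
        using step.IH hull_minimal[of X kernel "monoid_congruence k", OF X monoid_congruence_kernel] by blast
      then have du: "deg u = n" using less.prems by (auto simp: kernel_def)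
      have "(u, v) \<in> ?R"
      proof (cases "(u, v) \<in> linked")
        case True
        then obtain i where i: "0 < u i" "0 < v i" by (auto simp: linked_def)
        let ?u = "u(i := u i - 1)" and ?v = "v(i := v i - 1)"
        have nv: "u \<in> nvecs k" "v \<in> nvecs k" "deg u = deg v" using uv by (auto simp: kernel_def)
        have ik: "i < k" using nvecs_support nv i by blast
        have "deg u = deg ?u + g i" "deg v = deg ?v + g i"
          using deg_decrement nv i by auto
        then have "(?u, ?v) \<in> kernel" "deg ?u < n"
          using nv du decrement_nvecs weight_pos[OF ik] by (auto simp: kernel_def)
        then have "(?u, ?v) \<in> ?R" using less.IH by blast
        then have "((\<lambda>j. ?u j + unit_vec i j), (\<lambda>j. ?v j + unit_vec i j)) \<in> ?R"
          using R unit_vec_nvecs[OF ik] unfolding monoid_congruence_def by blast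
        then show ?thesis using decrement_add i by metis
      next
        case False
        then show ?thesis
          using step.hyps(2) XR eqR by (auto simp: equiv_def sym_def)
      qed
      then show ?case using step.IH eqR by (meson equiv_def transD)
    qed
  qed
  moreover have "?R \<subseteq> kernel" using hull_minimal[of X kernel "monoid_congruence k", OF X monoid_congruence_kernel] .
  ultimately show "?R = kernel" by auto
qed

section \<open>Minimal generating sets of the kernel\<close>

definition minimal_generating :: "(nat \<Rightarrow> nat) rel \<Rightarrow> bool" where
  "minimal_generating X \<longleftrightarrow> monoid_congruence k hull X = kernel \<and>
     (\<forall>Y. Y \<subset> X \<longrightarrow> monoid_congruence k hull Y \<noteq> kernel)"

lemma minimal_generating_subset_kernel: "minimal_generating X \<Longrightarrow> X \<subseteq> kernel"
  unfolding minimal_generating_def by (metis hull_subset)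

lemma minimal_generating_independent:
  assumes X: "minimal_generating X" and x: "x \<in> X"
  shows "x \<notin> eq_closure linked (X - {x})"
proof
  assume "x \<in> eq_closure linked (X - {x})"
  then have "X \<subseteq> eq_closure linked (X - {x})"
    using eq_closure_superset(2)[of "X - {x}" linked] by blast
  moreover have "kernel \<subseteq> eq_closure linked X"
    using X hull_eq_kernel_iff[OF minimal_generating_subset_kernel[OF X]]
    by (simp add: minimal_generating_def)
  ultimately have "kernel \<subseteq> eq_closure linked (X - {x})"
    using eq_closure_least[OF sym_linked, of X "X - {x}"] by blast
  moreover have "X - {x} \<subseteq> kernel"
    using minimal_generating_subset_kernel[OF X] by auto
  ultimately have "monoid_congruence k hull (X - {x}) = kernel"
    using hull_eq_kernel_iff by blast
  moreover have "X - {x} \<subset> X" using x by auto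
  ultimately show False using X by (auto simp: minimal_generating_def)
qed

text \<open>Any finite part of \<open>X\<close> inherits independence, so the exchange bound limits
  it by \<open>card Y\<close>; an infinite \<open>X\<close> would have parts of every finite
  size.\<close>

lemma minimal_generating_card_le:
  assumes X: "minimal_generating X" and Y: "finite Y" "monoid_congruence k hull Y = kernel"
  shows "finite X" and "card X \<le> card Y"
proof -
  have "Y \<subseteq> kernel" using Y hull_subset by metis
  then have sub: "X \<subseteq> eq_closure linked Y"
    using Y hull_eq_kernel_iff minimal_generating_subset_kernel[OF X] by blast
  have le: "card X' \<le> card Y" if "finite X'" "X' \<subseteq> X" for X'
  proof (rule eq_closure_independent_le[OF sym_linked \<open>finite Y\<close> \<open>finite X'\<close>])
    fix y assume "y \<in> X'"
    then show "y \<notin> eq_closure linked (X' - {y})"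
      using minimal_generating_independent[OF X, of y] that
        eq_closure_mono[of "X' - {y}" "X - {y}" linked] by blast
  qed (use sub that in auto)
  show "finite X"
  proof (rule ccontr)
    assume "infinite X"
    then obtain X' where "finite X'" "card X' = Suc (card Y)" "X' \<subseteq> X"
      using infinite_arbitrarily_large by metis
    then show False using le by fastforce
  qed
  then show "card X \<le> card Y" using le by auto
qed

lemma minimal_generating_exists:
  assumes "finite Y" "monoid_congruence k hull Y = kernel"
  shows "\<exists>X. minimal_generating X"
  using assms
proof (induction Y rule: finite_psubset_induct)
  case (psubset Y)
  then show ?case unfolding minimal_generating_def by blast
qed

section \<open>Standard vectors and corners\<close>

definition std :: "(nat \<Rightarrow> nat) \<Rightarrow> bool" where
  "std a \<longleftrightarrow> a \<in> nvecs k \<and> (\<forall>b\<in>nvecs k. deg b = deg a \<longrightarrow> \<not> lex_less a b)"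

lemma std_unique: "std a \<Longrightarrow> std b \<Longrightarrow> deg a = deg b \<Longrightarrow> a = b"
  unfolding std_def using lex_less_total by metis

lemma std_exists:
  assumes "a \<in> nvecs k"
  shows "\<exists>b. std b \<and> deg b = deg a"
proof -
  have "\<exists>m \<in> {b \<in> nvecs k. deg b = deg a}. \<forall>x \<in> {b \<in> nvecs k. deg b = deg a}. x \<noteq> m \<longrightarrow> \<not> lex_less m x"
  proof (rule Finite_Set.bex_max_element[OF finite_fiber])
    show "asymp_on {b \<in> nvecs k. deg b = deg a} lex_less"
      by (rule asymp_onI) (use lex_less_trans lex_less_irrefl in blast)
    show "transp_on {b \<in> nvecs k. deg b = deg a} lex_less"
      by (rule transp_onI) (use lex_less_trans in blast)
  qed (use assms in auto)
  then show ?thesis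
    unfolding std_def using lex_less_irrefl by (metis (mono_tags, lifting) mem_Collect_eq)
qed

text \<open>Translation invariance of \<open>lex_less\<close>: a larger factorization of the
  decremented vector would lift to one of \<open>a\<close>. This makes the standard vectors an order
  ideal.\<close>

lemma std_decrement:
  assumes a: "std a" shows "std (a(i := a i - 1))"
proof (cases "0 < a i")
  case True
  let ?a = "a(i := a i - 1)"
  have ak: "a \<in> nvecs k" using a by (simp add: std_def)
  have ik: "i < k" using nvecs_support ak True by blast
  have "\<not> lex_less ?a b" if b: "b \<in> nvecs k" "deg b = deg ?a" for b
  proof
    assume "lex_less ?a b"
    then have "lex_less (\<lambda>j. ?a j + unit_vec i j) (\<lambda>j. b j + unit_vec i j)"
      by (simp only: lex_less_add_iff)
    then have "lex_less a (\<lambda>j. b j + unit_vec i j)" using decrement_add[of a i, OF True] by simp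
    moreover have "deg (\<lambda>j. b j + unit_vec i j) = deg a"
      using deg_add b deg_decrement[OF ak True] deg_unit_vec[OF ik] by simp
    ultimately show False
      using a add_nvecs[OF b(1) unit_vec_nvecs[OF ik]] by (auto simp: std_def)
  qed
  then show ?thesis using decrement_nvecs[OF ak] by (simp add: std_def)
next
  case False
  then have "a(i := a i - 1) = a" by auto
  then show ?thesis using a by simp
qed

definition corners :: "(nat \<Rightarrow> nat) set" where
  "corners = {a \<in> nvecs k. \<not> std a \<and> (\<forall>i. 0 < a i \<longrightarrow> std (a(i := a i - 1)))}"

lemma corner_below:
  assumes "a \<in> nvecs k" "\<not> std a"
  shows "\<exists>c\<in>corners. \<exists>d\<in>nvecs k. a = (\<lambda>i. c i + d i)"
  using assms
proof (induction "deg a" arbitrary: a rule: less_induct)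
  case less
  show ?case
  proof (cases "a \<in> corners")
    case True
    then show ?thesis by (intro bexI[of _ a] bexI[of _ "\<lambda>_. 0"]) (auto simp: nvecs_def)
  next
    case False
    then obtain i where i: "0 < a i" "\<not> std (a(i := a i - 1))"
      using less.prems by (auto simp: corners_def)
    have ik: "i < k" using nvecs_support less.prems i by blast
    have "deg (a(i := a i - 1)) < deg a"
      using deg_decrement[OF less.prems(1) i(1)] weight_pos[OF ik] by simp
    then obtain c d where cd: "c \<in> corners" "d \<in> nvecs k" "a(i := a i - 1) = (\<lambda>j. c j + d j)"
      using less.hyps[of "a(i := a i - 1)"] decrement_nvecs[OF less.prems(1)] i by blast
    have "a = (\<lambda>j. c j + (d j + unit_vec i j))"
      using decrement_add[of a i] i(1) unfolding cd(3) by (simp add: add.assoc)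
    then show ?thesis
      using cd(1) add_nvecs[OF cd(2) unit_vec_nvecs[OF ik]] by (intro bexI)
  qed
qed

text \<open>Straightening a non-standard vector at a corner below it moves it up in its finite fibre, as
  in a Groebner basis.\<close>

lemma corners_generate:
  "\<exists>Y. monoid_congruence k hull Y = kernel \<and> (finite corners \<longrightarrow> finite Y \<and> card Y \<le> card corners)"
proof -
  define f where "f a = (SOME b. std b \<and> deg b = deg a)" for a
  have f: "std (f a)" "deg (f a) = deg a" if "a \<in> nvecs k" for a
    using someI_ex[OF std_exists[OF that]] by (auto simp: f_def)
  define Y where "Y = (\<lambda>a. (a, f a)) ` corners"
  have Y: "Y \<subseteq> kernel"
    using f by (auto simp: Y_def kernel_def corners_def std_def)
  let ?R = "monoid_congruence k hull Y"
  have R: "monoid_congruence k ?R"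
    using Y monoid_congruence_kernel by (intro monoid_congruence_hull) auto
  then have eqR: "equiv (nvecs k) ?R" unfolding monoid_congruence_def by simp
  have red: "(a, f a) \<in> ?R" if "a \<in> nvecs k" for a
    using that
  proof (induction "card {b \<in> nvecs k. deg b = deg a \<and> lex_less a b}" arbitrary: a rule: less_induct)
    case less
    show ?case
    proof (cases "std a")
      case True
      then have "f a = a" using std_unique f less.prems by blast
      then show ?thesis using eqR less.prems by (auto simp: equiv_def refl_on_def)
    next
      case False
      obtain c d where cd: "c \<in> corners" "d \<in> nvecs k" "a = (\<lambda>i. c i + d i)"
        using corner_below[OF less.prems False] by blast
      have ck: "c \<in> nvecs k" "\<not> std c" using cd by (auto simp: corners_def)
      let ?a = "\<lambda>i. f c i + d i"
      have fck: "f c \<in> nvecs k" using f[OF ck(1)] by (simp add: std_def)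
      have ak: "?a \<in> nvecs k" using add_nvecs[OF fck cd(2)] .
      have da: "deg ?a = deg a" using f[OF ck(1)] cd by (simp add: deg_add)
      have "lex_less c (f c)"
        using lex_less_total[of c "f c"] f[OF ck(1)] ck unfolding std_def by metis
      then have la: "lex_less a ?a" using cd by (simp add: lex_less_add_iff)
      have "(c, f c) \<in> ?R" using hull_subset[of Y] cd by (auto simp: Y_def)
      then have step: "(a, ?a) \<in> ?R"
        using R cd unfolding monoid_congruence_def by blast
      have "{b \<in> nvecs k. deg b = deg ?a \<and> lex_less ?a b} \<subset> {b \<in> nvecs k. deg b = deg a \<and> lex_less a b}"
        using la lex_less_trans[OF la] lex_less_irrefl[of ?a] ak da by auto
      moreover have "finite {b \<in> nvecs k. deg b = deg a \<and> lex_less a b}"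
        by (rule finite_subset[OF _ finite_fiber[of "deg a"]]) auto
      ultimately have "(?a, f ?a) \<in> ?R"
        using less.hyps ak psubset_card_mono by blast
      moreover have "f ?a = f a"
        by (rule std_unique[OF f(1)[OF ak] f(1)[OF less.prems]])
          (simp only: f(2)[OF ak] f(2)[OF less.prems] da)
      ultimately have "(?a, f a) \<in> ?R" by simp
      with step show ?thesis using eqR by (meson equiv_def transD)
    qed
  qed
  have "kernel \<subseteq> ?R"
  proof
    fix p assume p: "p \<in> kernel"
    obtain a b where ab: "p = (a, b)" by (cases p)
    have k: "a \<in> nvecs k" "b \<in> nvecs k" "deg a = deg b" using p ab by (auto simp: kernel_def)
    have symR: "sym ?R" using eqR by (simp add: equiv_def)
    have fab: "f a = f b"
      by (rule std_unique[OF f(1)[OF k(1)] f(1)[OF k(2)]]) (simp only: f(2)[OF k(1)] f(2)[OF k(2)] k(3))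
    then have "(a, f a) \<in> ?R" "(f a, b) \<in> ?R"
      using red[OF k(1)] symD[OF symR red[OF k(2)]] by simp_all
    then show "p \<in> ?R" using eqR ab by (metis equiv_def transD)
  qed
  then have "?R = kernel"
    using hull_minimal[of Y kernel "monoid_congruence k", OF Y monoid_congruence_kernel] by blast
  then show ?thesis
    unfolding Y_def using card_image_le by blast
qed

text \<open>Coordinate 0 is compared first, so a vector beating \<open>a\<close> contains variable 0
  whenever \<open>a\<close> does; cancelling it on both sides would beat the decrement of
  \<open>a\<close>, which is standard.\<close>

lemma corner_0:
  assumes a: "a \<in> corners" shows "a 0 = 0"
proof (rule ccontr)
  assume "a 0 \<noteq> 0"
  then have a0: "0 < a 0" by simp
  let ?a = "a(0 := a 0 - 1)"
  have ak: "a \<in> nvecs k" "\<not> std a" "std ?a" using a a0 by (auto simp: corners_def)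
  then obtain b where b: "b \<in> nvecs k" "deg b = deg a" "lex_less a b" by (auto simp: std_def)
  have b0: "0 < b 0" using lex_less_0[OF b(3)] a0 by simp
  let ?b = "b(0 := b 0 - 1)"
  have "lex_less (\<lambda>i. ?a i + unit_vec 0 i) (\<lambda>i. ?b i + unit_vec 0 i)"
    using b(3) decrement_add[of a 0] decrement_add[of b 0] a0 b0 by simp
  then have "lex_less ?a ?b" by (simp only: lex_less_add_iff)
  moreover have "deg ?b = deg ?a"
    using deg_decrement[OF ak(1) a0] deg_decrement[OF b(1) b0] b(2) by simp
  ultimately show False
    using ak(3) decrement_nvecs[OF b(1)] by (auto simp: std_def)
qed

text \<open>The degrees have distinct residues: if two of them are congruent modulo
  \<open>g 0\<close>, the vector of smaller degree plus \<open>q\<close> copies of variable 0 lies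
  in the fibre of the other and beats it unless \<open>q = 0\<close>.\<close>

lemma std_0_card:
  assumes "0 < k"
  shows "finite {a. std a \<and> a 0 = 0}" and "card {a. std a \<and> a 0 = 0} \<le> g 0"
proof -
  let ?S = "{a. std a \<and> a 0 = 0}"
  have less: "a = b" if ab: "std a" "std b" "b 0 = 0" "deg a \<le> deg b" "deg a mod g 0 = deg b mod g 0" for a b
  proof -
    obtain q where q: "deg b = deg a + g 0 * q"
      using ab(4,5) by (metis mod_eq_dvd_iff_nat dvd_def le_add_diff_inverse)
    let ?c = "\<lambda>i. a i + (if i = 0 then q else 0)"
    have "deg (\<lambda>i. if i = 0 then q else 0) = g 0 * q"
      unfolding deg_def using assms
      by (subst sum.cong[OF refl, of _ _ "\<lambda>j. if j = 0 then g 0 * q else 0"]) auto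
    then have dc: "deg ?c = deg b" using q by (simp add: deg_add)
    have ck: "?c \<in> nvecs k" using ab(1) assms by (auto simp: std_def nvecs_def)
    have "q = 0"
    proof (rule ccontr)
      assume "q \<noteq> 0"
      then have "lex_less b ?c" using ab(3) unfolding lex_less_def by (intro exI[of _ 0]) auto
      then show False using ab(2) ck dc by (auto simp: std_def)
    qed
    then show ?thesis using q std_unique ab by simp
  qed
  have inj: "inj_on (\<lambda>a. deg a mod g 0) ?S"
  proof (rule inj_onI)
    fix a b assume "a \<in> ?S" "b \<in> ?S" "deg a mod g 0 = deg b mod g 0"
    then show "a = b" using less[of a b] less[of b a] by (cases "deg a \<le> deg b") auto
  qed
  have sub: "(\<lambda>a. deg a mod g 0) ` ?S \<subseteq> {..<g 0}"
    using weight_pos[OF assms] by auto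
  then show "finite ?S" using inj by (meson finite_imageD finite_lessThan finite_subset)
  show "card ?S \<le> g 0"
    using card_inj_on_le[OF inj sub] by simp
qed

text \<open>A vector of \<open>A\<close> is linked to nothing but itself, so only its own pair
  \<open>(a, \<beta> a)\<close> leads away from it, and these pairs are independent. Base points
  outside \<open>A\<close> ensure that no other pair ends in \<open>a\<close>.\<close>

lemma card_isolated_le:
  assumes X: "monoid_congruence k hull X = kernel" "finite X" and A: "finite A"
    and iso: "\<And>a b. a \<in> A \<Longrightarrow> (a, b) \<in> linked \<Longrightarrow> b = a"
    and base: "\<And>a. a \<in> A \<Longrightarrow> \<exists>b. b \<notin> A \<and> (a, b) \<in> kernel"
  shows "card A \<le> card X"
proof -
  obtain \<beta> where \<beta>: "\<And>a. a \<in> A \<Longrightarrow> \<beta> a \<notin> A \<and> (a, \<beta> a) \<in> kernel"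
    using base by metis
  define Y where "Y = (\<lambda>a. (a, \<beta> a)) ` A"
  have "card Y \<le> card X"
  proof (rule eq_closure_independent_le[OF sym_linked \<open>finite X\<close>])
    show "finite Y" using A by (simp add: Y_def)
    have "X \<subseteq> kernel" using X hull_subset by metis
    then show "Y \<subseteq> eq_closure linked X"
      using X \<beta> hull_eq_kernel_iff by (auto simp: Y_def)
    fix y assume "y \<in> Y"
    then obtain a where a: "a \<in> A" "y = (a, \<beta> a)" by (auto simp: Y_def)
    have "v = a" if "(a, v) \<in> (linked \<union> (Y - {y}) \<union> (Y - {y})\<inverse>)\<^sup>*" for v
      using that
    proof (induction rule: rtrancl_induct)
      case (step u v)
      have "(a, v) \<notin> Y - {y}" using a by (auto simp: Y_def)
      moreover have "(v, a) \<notin> Y" using a(1) \<beta> by (metis (no_types, lifting) Y_def imageE prod.inject)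
      ultimately have "(a, v) \<in> linked" using step.hyps(2) step.IH by auto
      then show ?case by (rule iso[OF a(1)])
    qed simp
    then have "y \<in> eq_closure linked (Y - {y}) \<Longrightarrow> \<beta> a = a"
      unfolding eq_closure_def a(2) by blast
    moreover have "\<beta> a \<noteq> a" using a(1) \<beta> by metis
    ultimately show "y \<notin> eq_closure linked (Y - {y})" by blast
  qed
  moreover have "card Y = card A"
    unfolding Y_def by (intro card_image) (auto simp: inj_on_def)
  ultimately show ?thesis by simp
qed

end

section \<open>Order ideals of monomials\<close>

lemma size_eq_2E:
  assumes "size M = 2" obtains a b where "M = {#a, b#}"
  using assms by (metis numeral_2_eq_2 size_eq_Suc_imp_eq_union size_add_mset nat.inject size_eq_0_iff_empty)

lemma size_eq_3E:
  assumes "size M = 3" obtains a b c where "M = {#a, b, c#}"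
  using assms by (metis numeral_3_eq_3 numeral_2_eq_2 size_eq_Suc_imp_eq_union size_add_mset nat.inject size_eq_2E)

lemma card_multisets_size_2:
  assumes "finite V"
  shows "finite {M. set_mset M \<subseteq> V \<and> size M = 2}"
    and "card {M. set_mset M \<subseteq> V \<and> size M = 2} = (card V + 1) choose 2"
proof -
  have "finite {M. set_mset M \<subseteq> V \<and> size M = 2} \<and>
      card {M. set_mset M \<subseteq> V \<and> size M = 2} = (card V + 1) choose 2"
    using assms
  proof (induction V rule: finite_induct)
    case empty
    have "{M :: 'a multiset. set_mset M \<subseteq> {} \<and> size M = 2} = {}" by auto
    then show ?case by (simp add: numeral_2_eq_2)
  next
    case (insert v V)
    let ?Q = "\<lambda>V. {M. set_mset M \<subseteq> V \<and> size M = 2}"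
    have eq: "?Q (insert v V) = ?Q V \<union> (\<lambda>w. {#v, w#}) ` insert v V"
    proof (intro set_eqI iffI)
      fix M assume M: "M \<in> ?Q (insert v V)"
      then obtain a b where "M = {#a, b#}"
        by (auto elim: size_eq_2E)
      then show "M \<in> ?Q V \<union> (\<lambda>w. {#v, w#}) ` insert v V"
        using M by (auto simp: add_mset_commute)
    qed auto
    have "card ((\<lambda>w. {#v, w#}) ` insert v V) = card V + 1"
      using insert by (subst card_image) (auto simp: inj_on_def)
    moreover have "?Q V \<inter> (\<lambda>w. {#v, w#}) ` insert v V = {}"
      using insert.hyps by auto
    ultimately have "card (?Q (insert v V)) = ((card V + 1) choose 2) + (card V + 1)"
      unfolding eq using insert by (subst card_Un_disjoint) auto
    also have "\<dots> = (card (insert v V) + 1) choose 2"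
      using insert.hyps by (simp add: numeral_2_eq_2)
    finally show ?case using insert eq by simp
  qed
  then show "finite {M. set_mset M \<subseteq> V \<and> size M = 2}"
    and "card {M. set_mset M \<subseteq> V \<and> size M = 2} = (card V + 1) choose 2" by auto
qed

text \<open>Values of \<^term>\<open>macaulay_up n 2\<close> for \<open>n \<le> 5\<close>.\<close>

definition growth :: "nat \<Rightarrow> nat" where
  "growth n = (if n \<le> 2 then n else if n = 3 then 4 else if n = 4 then 5 else 7)"

text \<open>The numerical core of deleting a variable: \<open>min\<close> joins the two bounds for
  the cubics divisible by it. Equality occurs, for instance at \<open>h = 3\<close>,
  \<open>k = 2\<close> and at \<open>h = 5\<close>, \<open>k = 3\<close>.\<close>

lemma growth_step:
  assumes "2 \<le> k" "k \<le> h" "h \<le> 5"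
  shows "min h ((k + 1) choose 2) + growth (h - k) \<le> growth h"
proof -
  have "k \<in> {2, 3, 4, 5}" "h \<in> {2, 3, 4, 5}" using assms by auto
  then show ?thesis using assms by (auto simp: growth_def choose_two)
qed

text \<open>When \<open>B\<close> is the degree \<open>d\<close> part of an order ideal, with
  \<open>d\<close> positive, this set contains both the degree \<open>d + 1\<close> part and the
  corners of that degree, so one bound controls their sum.\<close>

definition all_facets_in :: "nat \<Rightarrow> 'a multiset set \<Rightarrow> 'a multiset set" where
  "all_facets_in d B = {M. size M = Suc d \<and> (\<forall>v\<in>#M. M - {#v#} \<in> B)}"

lemma all_facets_in_facet: "M \<in> all_facets_in d B \<Longrightarrow> v \<in># M \<Longrightarrow> M - {#v#} \<in> B"
  by (simp add: all_facets_in_def)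

lemma all_facets_in_size: "M \<in> all_facets_in d B \<Longrightarrow> size M = Suc d"
  by (simp add: all_facets_in_def)

text \<open>Some other occurrence \<open>w\<close> can be removed instead of \<open>v\<close>, so
  every variable of \<open>M\<close> already occurs in \<open>B\<close>. In degree 0 this breaks
  down: for \<open>B = {{#}}\<close> all singletons qualify.\<close>

lemma finite_all_facets_in:
  assumes B: "finite B" and d: "0 < d"
  shows "finite (all_facets_in d B)"
proof (rule finite_subset)
  let ?A = "\<Union>b\<in>B. set_mset b"
  show "all_facets_in d B \<subseteq> (\<lambda>(v, b). add_mset v b) ` (?A \<times> B)"
  proof
    fix M assume M: "M \<in> all_facets_in d B"
    then obtain v N where N: "M = add_mset v N"
      using all_facets_in_size size_eq_Suc_imp_eq_union by metis
    then have "N \<in> B" using all_facets_in_facet[OF M, of v] by simp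
    have "size N = d" using all_facets_in_size[OF M] N by simp
    then obtain w where w: "w \<in># N" using d by (cases N) auto
    then have "M - {#w#} \<in> B" using all_facets_in_facet[OF M, of w] N by simp
    moreover have "v \<in># M - {#w#} \<or> v = w" using N by (cases "v = w") auto
    ultimately have "v \<in> ?A" using \<open>N \<in> B\<close> w by blast
    then show "M \<in> (\<lambda>(v, b). add_mset v b) ` (?A \<times> B)" using N \<open>N \<in> B\<close> by auto
  qed
  show "finite ((\<lambda>(v, b). add_mset v b) ` (?A \<times> B))" using B by auto
qed

lemma card_all_facets_in_containing:
  assumes B: "finite B" and v: "\<And>M. M \<in> U \<Longrightarrow> v \<in># M \<and> M - {#v#} \<in> B"
  shows "card U \<le> card B"
proof (rule card_inj_on_le[OF _ _ B])
  show "inj_on (\<lambda>M. M - {#v#}) U"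
    using v by (intro inj_onI) (metis insert_DiffM)
qed (use v in auto)

text \<open>Delete a variable \<open>v\<close> dividing \<open>k \<ge> 2\<close> elements of \<open>B\<close>: the cubic monomials divisible by \<open>v\<close>
  inject into \<open>B\<close>, and into the quadratic monomials in the \<open>k\<close> neighbours of \<open>v\<close>.\<close>

lemma card_all_facets_in_2:
  assumes "finite B" and "card B \<le> 5"
  shows "card (all_facets_in 2 B) \<le> growth (card B)"
  using assms
proof (induction "card B" arbitrary: B rule: less_induct)
  case less
  let ?U = "all_facets_in 2 B"
  have finU: "finite ?U" using less.prems by (intro finite_all_facets_in) auto
  show ?case
  proof (cases "\<exists>v. 2 \<le> card {b\<in>B. v \<in># b}")
    case True
    then obtain v where v: "2 \<le> card {b\<in>B. v \<in># b}" by blast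
    let ?Bv = "{b\<in>B. v \<in># b}" and ?Uv = "{M\<in>?U. v \<in># M}" and ?N = "{c. {#v, c#} \<in> B}"
    have kh: "card ?Bv \<le> card B" using less.prems by (intro card_mono) auto
    have inj: "inj_on (\<lambda>c. {#v, c#}) ?N" by (auto simp: inj_on_def)
    have N: "finite ?N" "card ?N \<le> card ?Bv"
    proof -
      have im: "(\<lambda>c. {#v, c#}) ` ?N \<subseteq> ?Bv" by auto
      have "finite ?Bv" using less.prems by simp
      then show "finite ?N" using finite_imageD[OF finite_subset[OF im] inj] by blast
      show "card ?N \<le> card ?Bv" using card_inj_on_le[OF inj im] less.prems by simp
    qed
    have c1: "card ?Uv \<le> card B"
      using less.prems all_facets_in_facet by (intro card_all_facets_in_containing) auto
    have "?Uv \<subseteq> add_mset v ` {b. set_mset b \<subseteq> ?N \<and> size b = 2}"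
    proof
      fix M assume M: "M \<in> ?Uv"
      then obtain b where b: "M = add_mset v b" by (auto dest: multi_member_split)
      have sz: "size M = 3" using M all_facets_in_size by force
      then obtain p q where pq: "b = {#p, q#}"
        using b by (auto elim: size_eq_2E)
      have MU: "M \<in> ?U" "p \<in># M" "q \<in># M" using M b pq by auto
      have "M - {#p#} \<in> B" "M - {#q#} \<in> B"
        using all_facets_in_facet[OF MU(1) MU(2)] all_facets_in_facet[OF MU(1) MU(3)] .
      moreover have "M - {#p#} = {#v, q#}" "M - {#q#} = {#v, p#}" using b pq by auto
      ultimately have "{#v, p#} \<in> B" "{#v, q#} \<in> B" by simp_all
      then show "M \<in> add_mset v ` {b. set_mset b \<subseteq> ?N \<and> size b = 2}"
        using b pq by auto
    qed
    then have "card ?Uv \<le> card (add_mset v ` {b. set_mset b \<subseteq> ?N \<and> size b = 2})"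
      using card_multisets_size_2[OF N(1)] by (intro card_mono) auto
    also have "\<dots> \<le> (card ?N + 1) choose 2"
      using card_image_le[OF card_multisets_size_2(1)[OF N(1)], of "add_mset v"]
      unfolding card_multisets_size_2(2)[OF N(1)] .
    also have "\<dots> \<le> (card ?Bv + 1) choose 2"
      using N(2) by (intro binomial_right_mono) auto
    finally have c2: "card ?Uv \<le> (card ?Bv + 1) choose 2" .
    have cB: "card (B - ?Bv) = card B - card ?Bv"
      using less.prems by (intro card_Diff_subset) auto
    have "?U - ?Uv \<subseteq> all_facets_in 2 (B - ?Bv)"
      by (auto simp: all_facets_in_def dest: in_diffD)
    then have "card (?U - ?Uv) \<le> card (all_facets_in 2 (B - ?Bv))"
      using less.prems by (intro card_mono finite_all_facets_in) auto
    also have "\<dots> \<le> growth (card (B - ?Bv))"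
      using less.prems v kh cB by (intro less.hyps) auto
    finally have c3: "card (?U - ?Uv) \<le> growth (card B - card ?Bv)" using cB by simp
    have "card ?U = card ?Uv + card (?U - ?Uv)"
      using finU by (subst card_Un_disjoint[symmetric]) (auto intro: arg_cong[of _ _ card])
    moreover have "min (card B) ((card ?Bv + 1) choose 2) + growth (card B - card ?Bv) \<le> growth (card B)"
      using growth_step[OF v kh less.prems(2)] .
    ultimately show ?thesis using c1 c2 c3 by linarith
  next
    case False
    \<comment> \<open>No variable divides two elements of \<open>B\<close>, so facets of a cubic
      that share a variable coincide, and only cubes remain.\<close>
    have uniq: "b = c" if "b \<in> B" "c \<in> B" "v \<in># b" "v \<in># c" for b c v
    proof (rule ccontr)
      assume "b \<noteq> c"
      then have "card {b, c} \<le> card {b\<in>B. v \<in># b}"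
        using that less.prems by (intro card_mono) auto
      then show False using False \<open>b \<noteq> c\<close> by (auto simp: numeral_2_eq_2)
    qed
    have "?U \<subseteq> (\<lambda>p. {#p, p, p#}) ` {p. {#p, p#} \<in> B}"
    proof
      fix M assume M: "M \<in> ?U"
      have sz: "size M = 3" using M all_facets_in_size by force
      then obtain p q r where pqr: "M = {#p, q, r#}"
        by (auto elim: size_eq_3E)
      have "p \<in># M" "q \<in># M" "r \<in># M" using pqr by auto
      then have "M - {#p#} \<in> B" "M - {#q#} \<in> B" "M - {#r#} \<in> B"
        using all_facets_in_facet[OF M] by blast+
      moreover have "M - {#p#} = {#q, r#}" "M - {#q#} = {#p, r#}" "M - {#r#} = {#p, q#}"
        using pqr by auto
      ultimately have B: "{#q, r#} \<in> B" "{#p, r#} \<in> B" "{#p, q#} \<in> B" by auto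
      have "{#p, r#} = {#p, q#}" "{#q, r#} = {#p, q#}"
        using uniq[OF B(2,3), of p] uniq[OF B(1,3), of q] by auto
      then have "r = q" "r = p" by (auto simp: add_eq_conv_ex)
      then show "M \<in> (\<lambda>p. {#p, p, p#}) ` {p. {#p, p#} \<in> B}" using pqr B by auto
    qed
    moreover
    have inj: "inj_on (\<lambda>p. {#p, p#}) {p. {#p, p#} \<in> B}"
      by (rule inj_onI) (auto simp: add_eq_conv_ex)
    have im: "(\<lambda>p. {#p, p#}) ` {p. {#p, p#} \<in> B} \<subseteq> B" by auto
    have "finite {p. {#p, p#} \<in> B}"
      using finite_imageD[OF finite_subset[OF im less.prems(1)] inj] .
    ultimately have "card ?U \<le> card {p. {#p, p#} \<in> B}"
      by (meson card_image_le card_mono finite_imageI le_trans)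
    also have "\<dots> \<le> card B" by (rule card_inj_on_le[OF inj im less.prems(1)])
    also have "\<dots> \<le> growth (card B)" using less.prems by (auto simp: growth_def)
    finally show ?thesis .
  qed
qed

text \<open>If one variable divides all of \<open>B\<close>, cancelling it is injective. Otherwise a
  monomial with two distinct variables would have two distinct facets, which exhaust
  \<open>B\<close> and for \<open>d \<ge> 2\<close> share a variable; so only pure powers are left.
  For \<open>d = 1\<close> two variables already give three quadratic monomials.\<close>

lemma card_all_facets_in_small:
  assumes B: "finite B" "card B \<le> 2" and d: "2 \<le> d"
  shows "card (all_facets_in d B) \<le> card B"
proof (cases "\<exists>v. \<forall>b\<in>B. v \<in># b")
  case True
  then obtain v where v: "\<And>b. b \<in> B \<Longrightarrow> v \<in># b" by blast
  show ?thesis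
  proof (rule card_all_facets_in_containing[OF B(1), where v = v])
    fix M assume M: "M \<in> all_facets_in d B"
    then obtain w N where "M = add_mset w N"
      using all_facets_in_size size_eq_Suc_imp_eq_union by metis
    then have "v \<in># M" using v all_facets_in_facet[OF M, of w] by auto
    then show "v \<in># M \<and> M - {#v#} \<in> B" using all_facets_in_facet[OF M] by auto
  qed
next
  case False
  have pure: "M = replicate_mset (Suc d) v" if M: "M \<in> all_facets_in d B" "v \<in># M" for M v
  proof (rule ccontr)
    assume "M \<noteq> replicate_mset (Suc d) v"
    then obtain w where w: "w \<in># M" "w \<noteq> v"
      using all_facets_in_size[OF M(1)] set_mset_subset_singletonD[of M v] by auto
    let ?b = "M - {#v#}" and ?c = "M - {#w#}"
    have bc: "?b \<in> B" "?c \<in> B" using all_facets_in_facet[OF M(1)] M w by auto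
    have "count ?b v < count ?c v" using w M(2) by simp
    then have "?b \<noteq> ?c" by (metis less_irrefl)
    then have "{?b, ?c} = B" using bc B by (intro card_seteq) auto
    moreover have "M - {#v#} - {#w#} \<noteq> {#}"
    proof -
      obtain N where N: "M = add_mset v N" using M(2) by (blast dest: multi_member_split)
      then obtain N' where "N = add_mset w N'" using w by (auto dest: multi_member_split)
      then show ?thesis using N d all_facets_in_size[OF M(1)] by auto
    qed
    then obtain u where u: "u \<in># M - {#v#} - {#w#}" by (meson multiset_nonemptyE)
    then have "u \<in># ?b" by (rule in_diffD)
    moreover have "u \<in># ?c" using u in_diffD[of u ?c "{#v#}"] by (simp add: add_mset_commute)
    ultimately show False using False by blast
  qed
  let ?f = "\<lambda>v. replicate_mset (Suc d) v" and ?V = "{v. replicate_mset d v \<in> B}"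
  have inj: "inj_on (replicate_mset d) ?V"
    using d by (auto simp: inj_on_def replicate_mset_eq_iff)
  have im: "replicate_mset d ` ?V \<subseteq> B" by auto
  have fin: "finite ?V" using finite_imageD[OF finite_subset[OF im B(1)] inj] .
  have "all_facets_in d B \<subseteq> ?f ` ?V"
  proof
    fix M assume M: "M \<in> all_facets_in d B"
    then obtain v N where N: "M = add_mset v N"
      using all_facets_in_size size_eq_Suc_imp_eq_union by metis
    then have "M = ?f v" using pure[OF M, of v] by auto
    moreover have "M - {#v#} \<in> B" using all_facets_in_facet[OF M, of v] N by auto
    ultimately show "M \<in> ?f ` ?V" by auto
  qed
  then have "card (all_facets_in d B) \<le> card ?V"
    using fin by (meson card_image_le card_mono finite_imageI le_trans)
  also have "\<dots> \<le> card B" by (rule card_inj_on_le[OF inj im B(1)])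
  finally show ?thesis .
qed

text \<open>Count by degree, \<open>Nd\<close> for corners and \<open>Pd\<close> for the ideal:
  \<open>Nd 2\<close> and \<open>Pd 2\<close> share the quadratic monomials, \<open>Nd 3\<close> and
  \<open>Pd 3\<close> together have at most \<open>growth (card (Pd 2))\<close> elements, and the
  corners of degree at least 4 number at most \<open>card (Pd 3)\<close>. In the sum
  \<open>card (Pd 3)\<close> cancels, leaving a bound in terms of
  \<open>card (Pd 2) \<le> s\<close>.\<close>

lemma card_multiset_corners:
  assumes V: "finite V" "V \<noteq> {}" and P: "finite P"
    and ideal: "\<And>M v. M \<in> P \<Longrightarrow> v \<in># M \<Longrightarrow> M - {#v#} \<in> P"
    and singles: "\<And>v. v \<in> V \<Longrightarrow> {#v#} \<in> P"
    and PV: "\<And>M. M \<in> P \<Longrightarrow> set_mset M \<subseteq> V"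
    and cP: "card P \<le> 1 + card V + s" and s: "s \<le> 5"
  defines "N \<equiv> {M. set_mset M \<subseteq> V \<and> M \<notin> P \<and> (\<forall>v\<in>#M. M - {#v#} \<in> P)}"
  shows "finite N" and "card N + s \<le> ((card V + 1) choose 2) + growth s"
proof -
  have empty: "{#} \<in> P" using V singles ideal by (metis all_not_in_conv add_mset_remove_trivial union_single_eq_member)
  define Pd where "Pd d = {M\<in>P. size M = d}" for d
  define Nd where "Nd d = {M\<in>N. size M = d}" for d
  have big: "2 \<le> size M" if "M \<in> N" for M
  proof (rule ccontr)
    assume "\<not> 2 \<le> size M"
    then consider "size M = 0" | "size M = 1" by linarith
    then show False
    proof cases
      case 2
      then obtain v where "M = {#v#}" using size_1_singleton_mset by blast
      then show False using that singles by (auto simp: N_def)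
    qed (use that empty in \<open>auto simp: N_def\<close>)
  qed
  have "N \<subseteq> (\<lambda>(v, b). add_mset v b) ` (V \<times> P)"
  proof
    fix M assume M: "M \<in> N"
    then obtain v where v: "v \<in># M" using big[of M] by (cases M) auto
    then have "M = add_mset v (M - {#v#})" "v \<in> V" "M - {#v#} \<in> P"
      using M by (auto simp: N_def)
    then show "M \<in> (\<lambda>(v, b). add_mset v b) ` (V \<times> P)"
      by (intro image_eqI[of _ _ "(v, M - {#v#})"]) simp_all
  qed
  then show finN: "finite N" using V P by (auto intro: finite_subset)
  have finPd: "finite (Pd d)" and finNd: "finite (Nd d)" for d
    using P finN by (auto simp: Pd_def Nd_def)
  have facets: "card (Nd (Suc d)) + card (Pd (Suc d)) \<le> card (all_facets_in d (Pd d))" if "0 < d" for d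
  proof -
    have "Nd (Suc d) \<union> Pd (Suc d) \<subseteq> all_facets_in d (Pd d)"
      using ideal by (auto simp: Nd_def Pd_def all_facets_in_def N_def size_Diff_singleton)
    moreover have "Nd (Suc d) \<inter> Pd (Suc d) = {}" by (auto simp: Nd_def Pd_def N_def)
    ultimately show ?thesis
      using finite_all_facets_in[OF finPd that] finPd finNd
      by (metis card_Un_disjoint card_mono)
  qed
  have sum: "card (Pd 2) + card (Pd 3) \<le> s"
  proof -
    have "card (insert {#} ((\<lambda>v. {#v#}) ` V)) = 1 + card V"
      using V by (subst card_insert_disjoint) (auto simp: card_image inj_on_def)
    moreover have "card (insert {#} ((\<lambda>v. {#v#}) ` V) \<union> (Pd 2 \<union> Pd 3)) =
        card (insert {#} ((\<lambda>v. {#v#}) ` V)) + (card (Pd 2) + card (Pd 3))"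
    proof -
      have "card (Pd 2 \<union> Pd 3) = card (Pd 2) + card (Pd 3)"
        using finPd by (intro card_Un_disjoint) (auto simp: Pd_def)
      then show ?thesis
        using V finPd by (subst card_Un_disjoint) (auto simp: Pd_def)
    qed
    moreover have "card (insert {#} ((\<lambda>v. {#v#}) ` V) \<union> (Pd 2 \<union> Pd 3)) \<le> card P"
      using P empty singles by (intro card_mono) (auto simp: Pd_def)
    ultimately show ?thesis using cP by linarith
  qed
  have g2: "card (Nd 3) + card (Pd 3) \<le> growth (card (Pd 2))"
    using facets[of 2] card_all_facets_in_2[OF finPd[of 2]] sum s by (simp add: numeral_3_eq_3)
  \<comment> \<open>If \<open>card (Pd 2) \<le> 2\<close>, then \<open>growth\<close> does not
    exceed 2; otherwise \<open>sum\<close> leaves room for at most \<open>5 - 3\<close>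
    cubics.\<close>
  have h3: "card (Pd 3) \<le> 2"
    using g2 sum s by (auto simp: growth_def split: if_splits)
  \<comment> \<open>Telescoping: the corners of degree \<open>D + 1\<close> are paid for by the drop
    from \<open>card (Pd D)\<close> to \<open>card (Pd (D + 1))\<close>.\<close>
  have tail: "card {M\<in>N. 4 \<le> size M \<and> size M \<le> D} + card (Pd D) \<le> card (Pd 3)" if "3 \<le> D" for D
    using that
  proof (induction D rule: dec_induct)
    case base
    have e: "{M\<in>N. 4 \<le> size M \<and> size M \<le> 3} = {}" by auto
    show ?case unfolding e by simp
  next
    case (step D)
    have "card (all_facets_in D (Pd D)) \<le> card (Pd D)"
      using step.IH step.hyps h3 by (intro card_all_facets_in_small finPd) auto
    then have "card (Nd (Suc D)) + card (Pd (Suc D)) \<le> card (Pd D)"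
      using facets[of D] step.hyps by simp
    moreover have "card {M\<in>N. 4 \<le> size M \<and> size M \<le> Suc D} \<le>
        card ({M\<in>N. 4 \<le> size M \<and> size M \<le> D} \<union> Nd (Suc D))"
      using finN by (intro card_mono) (auto simp: Nd_def)
    moreover have "\<dots> \<le> card {M\<in>N. 4 \<le> size M \<and> size M \<le> D} + card (Nd (Suc D))"
      by (rule card_Un_le)
    ultimately show ?case using step.IH by linarith
  qed
  \<comment> \<open>\<open>D\<close> bounds the degrees of all corners; 3 is where the telescoping
    starts.\<close>
  define D where "D = max 3 (Max (size ` N))"
  have "size M \<le> D" if "M \<in> N" for M
    using that finN by (auto simp: D_def intro: max.coboundedI2)
  then have "{M\<in>N. 4 \<le> size M \<and> size M \<le> D} = {M\<in>N. 4 \<le> size M}" by auto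
  with tail[of D] have N4: "card {M\<in>N. 4 \<le> size M} \<le> card (Pd 3)" by (simp add: D_def)
  have "N \<subseteq> Nd 2 \<union> Nd 3 \<union> {M\<in>N. 4 \<le> size M}"
    using big by (force simp: Nd_def)
  then have "card N \<le> card (Nd 2 \<union> Nd 3 \<union> {M\<in>N. 4 \<le> size M})"
    using finN finNd by (intro card_mono) auto
  also have "\<dots> \<le> card (Nd 2) + card (Nd 3) + card {M\<in>N. 4 \<le> size M}"
    using card_Un_le[of "Nd 2 \<union> Nd 3"] card_Un_le[of "Nd 2" "Nd 3"] by (meson add_le_mono1 le_trans)
  finally have N: "card N \<le> \<dots>" .
  have "card (Nd 2) + card (Pd 2) \<le> (card V + 1) choose 2"
  proof -
    have "card (Nd 2 \<union> Pd 2) \<le> card {M. set_mset M \<subseteq> V \<and> size M = 2}"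
      using card_multisets_size_2[OF V(1)] PV by (intro card_mono) (auto simp: Nd_def Pd_def N_def)
    moreover have "Nd 2 \<inter> Pd 2 = {}" by (auto simp: Nd_def Pd_def N_def)
    ultimately show ?thesis
      using card_multisets_size_2[OF V(1)] finPd finNd by (metis card_Un_disjoint)
  qed
  then have "card N + card (Pd 2) \<le> ((card V + 1) choose 2) + growth (card (Pd 2))"
    using N N4 g2 by linarith
  \<comment> \<open>The excess \<open>growth h - h\<close> never decreases up to 5, so the worst
    case is that all \<open>s\<close> spare monomials are quadratic.\<close>
  moreover have "growth h + s \<le> growth s + h" if "h \<le> s" for h
    using that s by (auto simp: growth_def)
  ultimately show "card N + s \<le> ((card V + 1) choose 2) + growth s"
    using sum by (smt (verit) add_leD1 add_le_cancel_left add.assoc add.commute le_trans)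
qed

section \<open>Numerical monoids and their minimal generators\<close>

definition irreducibles :: "nat set \<Rightarrow> nat set" where
  "irreducibles \<Gamma> = {n \<in> \<Gamma>. n \<noteq> 0 \<and> (\<forall>a\<in>\<Gamma>. \<forall>b\<in>\<Gamma>. n = a + b \<longrightarrow> a = 0 \<or> b = 0)}"

lemma add_submonoid_hull: "add_submonoid (add_submonoid hull A)"
  by (rule hull_in) (auto simp: add_submonoid_def)

lemma hull_irreducibles:
  assumes "add_submonoid \<Gamma>"
  shows "add_submonoid hull irreducibles \<Gamma> = \<Gamma>"
proof
  show "add_submonoid hull irreducibles \<Gamma> \<subseteq> \<Gamma>"
    using assms by (intro hull_minimal) (auto simp: irreducibles_def)
  have hull: "0 \<in> add_submonoid hull irreducibles \<Gamma>"
    "\<And>x y. x \<in> add_submonoid hull irreducibles \<Gamma> \<Longrightarrow> y \<in> add_submonoid hull irreducibles \<Gamma> \<Longrightarrow>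
      x + y \<in> add_submonoid hull irreducibles \<Gamma>"
    using add_submonoid_hull[of "irreducibles \<Gamma>"]
    unfolding add_submonoid_def[of "add_submonoid hull irreducibles \<Gamma>"] by blast+
  have "n \<in> \<Gamma> \<Longrightarrow> n \<in> add_submonoid hull irreducibles \<Gamma>" for n
  proof (induction n rule: less_induct)
    case (less n)
    show ?case
    proof (cases "n = 0 \<or> n \<in> irreducibles \<Gamma>")
      case True
      then show ?thesis
        using hull(1) hull_subset[of "irreducibles \<Gamma>" add_submonoid] by auto
    next
      case False
      then obtain a b where "a \<in> \<Gamma>" "b \<in> \<Gamma>" "n = a + b" "a \<noteq> 0" "b \<noteq> 0"
        using less.prems by (auto simp: irreducibles_def)
      then show ?thesis
        using less.IH[of a] less.IH[of b] hull(2) by auto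
    qed
  qed
  then show "\<Gamma> \<subseteq> add_submonoid hull irreducibles \<Gamma>" by blast
qed

text \<open>Removing an irreducible element leaves a submonoid, which would contain the hull of any
  generating set avoiding that element.\<close>

lemma irreducibles_subset_generators:
  assumes "add_submonoid hull A = \<Gamma>"
  shows "irreducibles \<Gamma> \<subseteq> A"
proof
  fix n assume n: "n \<in> irreducibles \<Gamma>"
  show "n \<in> A"
  proof (rule ccontr)
    assume "n \<notin> A"
    have \<Gamma>: "add_submonoid \<Gamma>" using assms add_submonoid_hull by metis
    have "A \<subseteq> \<Gamma>" using assms hull_subset by metis
    then have "A \<subseteq> \<Gamma> - {n}" using \<open>n \<notin> A\<close> by auto
    moreover have "add_submonoid (\<Gamma> - {n})"
      unfolding add_submonoid_def
    proof (intro conjI ballI)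
      fix x y assume xy: "x \<in> \<Gamma> - {n}" "y \<in> \<Gamma> - {n}"
      then have "n = x + y \<Longrightarrow> x = 0 \<or> y = 0" using n unfolding irreducibles_def by blast
      then show "x + y \<in> \<Gamma> - {n}" using \<Gamma> xy by (auto simp: add_submonoid_def)
    qed (use \<Gamma> n in \<open>auto simp: add_submonoid_def irreducibles_def\<close>)
    ultimately have "\<Gamma> \<subseteq> \<Gamma> - {n}"
      using assms hull_minimal[of A "\<Gamma> - {n}" add_submonoid] by simp
    then show False using n by (auto simp: irreducibles_def)
  qed
qed

text \<open>The irreducibles generate and lie in every generating set; this gives the uniqueness
  that the \<open>THE\<close> in \<open>min_gens\<close> relies on.\<close>

lemma min_gens_eq_irreducibles:
  assumes "add_submonoid \<Gamma>"
  shows "min_gens \<Gamma> = irreducibles \<Gamma>"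
  unfolding min_gens_def min_generating_set_def
proof (rule the_equality)
  show "add_submonoid hull irreducibles \<Gamma> = \<Gamma> \<and> (\<forall>B\<subset>irreducibles \<Gamma>. add_submonoid hull B \<noteq> \<Gamma>)"
    using hull_irreducibles[OF assms] irreducibles_subset_generators by blast
next
  fix A assume "add_submonoid hull A = \<Gamma> \<and> (\<forall>B\<subset>A. add_submonoid hull B \<noteq> \<Gamma>)"
  then show "A = irreducibles \<Gamma>"
    using hull_irreducibles[OF assms] irreducibles_subset_generators[of A \<Gamma>] by blast
qed

section \<open>Factorizations over the minimal generators\<close>

locale generated_monoid =
  fixes \<Gamma> :: "nat set" and k :: nat
  assumes submonoid: "add_submonoid \<Gamma>"
    and finite_irreducibles: "finite (irreducibles \<Gamma>)"
    and card_irreducibles: "card (irreducibles \<Gamma>) = k"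
    and k_pos: "0 < k"
begin

lemma edim_eq: "edim \<Gamma> = k"
  by (simp add: edim_def min_gens_eq_irreducibles[OF submonoid] card_irreducibles)

lemma bij_gen: "bij_betw (gen \<Gamma>) {..<k} (irreducibles \<Gamma>)"
proof -
  have "bij_betw ((!) (sorted_list_of_set (irreducibles \<Gamma>))) {..<k} (irreducibles \<Gamma>)"
    using finite_irreducibles card_irreducibles by (intro bij_betw_nth) auto
  moreover have "gen \<Gamma> = (!) (sorted_list_of_set (irreducibles \<Gamma>))"
    by (auto simp: gen_def min_gens_eq_irreducibles[OF submonoid])
  ultimately show ?thesis by simp
qed

lemma gen_irreducible: "i < k \<Longrightarrow> gen \<Gamma> i \<in> irreducibles \<Gamma>"
  using bij_gen by (auto simp: bij_betw_def)

lemma gen_eq_iff: "i < k \<Longrightarrow> j < k \<Longrightarrow> gen \<Gamma> i = gen \<Gamma> j \<longleftrightarrow> i = j"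
  using bij_gen by (auto simp: bij_betw_def inj_on_def)

lemma gen_0: "gen \<Gamma> 0 = Defs.mult \<Gamma>"
proof -
  have "irreducibles \<Gamma> \<noteq> {}" using card_irreducibles k_pos by auto
  then show ?thesis
    using finite_irreducibles
    by (simp add: gen_def Defs.mult_def min_gens_eq_irreducibles[OF submonoid] sorted_list_of_set_nonempty)
qed

sublocale positive_weights k "gen \<Gamma>"
  by standard (use gen_irreducible in \<open>auto simp: irreducibles_def\<close>)

lemma ker_phi_eq: "ker_phi \<Gamma> = kernel"
  by (simp add: ker_phi_def kernel_def edim_eq phi_def deg_def)

lemma min_relations_eq: "min_relations \<Gamma> X \<longleftrightarrow> minimal_generating X"
  by (simp add: min_relations_def minimal_generating_def edim_eq ker_phi_eq)

lemma deg_mem: "deg a \<in> \<Gamma>"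
proof -
  have mult: "n * x \<in> \<Gamma>" if "x \<in> \<Gamma>" for n x
    using submonoid that by (induction n) (auto simp: add_submonoid_def)
  have "(\<Sum>i<j. a i * gen \<Gamma> i) \<in> \<Gamma>" if "j \<le> k" for j
    using that
  proof (induction j)
    case (Suc j)
    have "gen \<Gamma> j \<in> \<Gamma>" using gen_irreducible[of j] Suc.prems by (simp add: irreducibles_def)
    then show ?case
      using mult[of "gen \<Gamma> j" "a j"] Suc submonoid by (auto simp: add_submonoid_def)
  qed (use submonoid in \<open>auto simp: add_submonoid_def\<close>)
  then show ?thesis by (simp add: deg_def)
qed

lemma deg_surj:
  assumes "n \<in> \<Gamma>" shows "\<exists>a\<in>nvecs k. deg a = n"
proof -
  let ?D = "deg ` nvecs k"
  have "(\<lambda>_. 0) \<in> nvecs k" "deg (\<lambda>_. 0) = 0" by (auto simp: nvecs_def deg_def)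
  then have "0 \<in> ?D" by (metis image_eqI)
  moreover have "x + y \<in> ?D" if xy: "x \<in> ?D" "y \<in> ?D" for x y
  proof -
    obtain a b where "a \<in> nvecs k" "b \<in> nvecs k" "x = deg a" "y = deg b" using xy by auto
    then show ?thesis
      using add_nvecs by (intro image_eqI[of _ _ "\<lambda>i. a i + b i"]) (auto simp: deg_add)
  qed
  ultimately have "add_submonoid ?D" unfolding add_submonoid_def by blast
  moreover have "irreducibles \<Gamma> \<subseteq> ?D"
  proof
    fix x assume "x \<in> irreducibles \<Gamma>"
    then obtain i where "i < k" "x = gen \<Gamma> i" using bij_gen by (auto simp: bij_betw_def)
    then show "x \<in> ?D" using unit_vec_nvecs deg_unit_vec by (metis image_eqI)
  qed
  ultimately have "\<Gamma> \<subseteq> ?D"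
    using hull_irreducibles[OF submonoid] hull_minimal by metis
  then show ?thesis using assms by auto
qed

lemma deg_eq_0: "a \<in> nvecs k \<Longrightarrow> deg a = 0 \<Longrightarrow> a i = 0"
  using deg_ge_coord[of a i] by simp

lemma gen_unique_factorization:
  assumes b: "b \<in> nvecs k" "deg b = gen \<Gamma> i" and i: "i < k"
  shows "b = unit_vec i"
proof -
  have "\<exists>j. 0 < b j"
  proof (rule ccontr)
    assume "\<not> ?thesis"
    then have "deg b = 0" by (simp add: deg_def)
    then show False using b weight_pos[OF i] by simp
  qed
  then obtain j where j: "0 < b j" by blast
  have jk: "j < k" using nvecs_support[OF b(1) j] .
  let ?c = "b(j := b j - 1)"
  have sum: "gen \<Gamma> i = deg ?c + gen \<Gamma> j" using deg_decrement[OF b(1) j] b by simp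
  have "gen \<Gamma> j \<in> \<Gamma>" using gen_irreducible[OF jk] by (simp add: irreducibles_def)
  then have "deg ?c = 0"
    using gen_irreducible[OF i] sum deg_mem[of ?c] weight_pos[OF jk]
    unfolding irreducibles_def by fastforce
  then have "?c = (\<lambda>_. 0)" using deg_eq_0[OF decrement_nvecs[OF b(1)]] by blast
  then have "b = unit_vec j" using decrement_add[of b j, OF j] by simp
  moreover have "i = j" using sum \<open>deg ?c = 0\<close> gen_eq_iff[OF i jk] by simp
  ultimately show ?thesis by simp
qed

lemma std_unit_vec: "i < k \<Longrightarrow> std (unit_vec i)"
  unfolding std_def
  using unit_vec_nvecs deg_unit_vec gen_unique_factorization lex_less_irrefl by metis

section \<open>Multisets as exponent vectors, and bounds for \<open>rho\<close>\<close>

lemma count_decrement: "count (M - {#v#}) = (count M)(v := count M v - 1)"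
  by auto

lemma count_nvecs: "count M \<in> nvecs k \<longleftrightarrow> set_mset M \<subseteq> {..<k}"
  by (auto simp: nvecs_def not_in_iff[symmetric] subset_iff) (meson leI)

lemma nvecs_count:
  assumes "a \<in> nvecs k" obtains M where "a = count M" "set_mset M \<subseteq> {..<k}"
proof -
  have "finite {i. 0 < a i}"
    using nvecs_support[OF assms] by (auto intro: finite_subset[of _ "{..<k}"])
  then have "count (Abs_multiset a) = a" by simp
  then show ?thesis
    using that[of "Abs_multiset a"] count_nvecs[of "Abs_multiset a"] assms by metis
qed

lemma deg_count: "set_mset M \<subseteq> {..<k} \<Longrightarrow> deg (count M) = (\<Sum>i\<in>#M. gen \<Gamma> i)"
proof (induction M)
  case (add i M)
  have "count (add_mset i M) = (\<lambda>j. count M j + unit_vec i j)" by (auto simp: unit_vec_def)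
  then show ?case using add by (simp add: deg_add deg_unit_vec)
qed (simp add: deg_def)

text \<open>For \<open>k = e + 1\<close> there are \<open>k - 1\<close> variables besides the
  multiplicity, hence \<open>k choose 2\<close> quadratic monomials. The ideal of standard monomials
  without variable 0 has at most \<open>k + s\<close> elements: 1, the variables and at most
  \<open>s\<close> more.\<close>

lemma corners_bound:
  assumes m: "Defs.mult \<Gamma> \<le> k + s" and s: "s \<le> 5" and k: "2 \<le> k"
  shows "finite corners" and "card corners + s \<le> (k choose 2) + growth s"
proof -
  let ?V = "{1..<k}"
  let ?P = "{M. std (count M) \<and> count M 0 = 0}"
  let ?N = "{M. set_mset M \<subseteq> ?V \<and> M \<notin> ?P \<and> (\<forall>v\<in>#M. M - {#v#} \<in> ?P)}"
  have inj: "inj_on count A" for A :: "nat multiset set" by (auto simp: inj_on_def count_inject)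
  have Pim: "count ` ?P \<subseteq> {a. std a \<and> a 0 = 0}" by auto
  have finP: "finite ?P"
    using finite_imageD[OF finite_subset[OF Pim std_0_card(1)[OF k_pos]] inj] .
  have "card ?P \<le> Defs.mult \<Gamma>"
    using card_inj_on_le[OF inj Pim std_0_card(1)[OF k_pos]] std_0_card(2)[OF k_pos] gen_0 by simp
  then have cP: "card ?P \<le> 1 + card ?V + s" using m k by simp
  have ideal: "M - {#v#} \<in> ?P" if "M \<in> ?P" "v \<in># M" for M v
    using that std_decrement[of "count M" v] by (auto simp: count_decrement)
  have singles: "{#v#} \<in> ?P" if "v \<in> ?V" for v
  proof -
    have "count {#v#} = unit_vec v" by (auto simp: unit_vec_def)
    then show ?thesis using that std_unit_vec[of v] by simp
  qed
  have PV: "set_mset M \<subseteq> ?V" if "M \<in> ?P" for M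
  proof -
    have "set_mset M \<subseteq> {..<k}" "0 \<notin># M"
      using that count_nvecs by (auto simp: std_def not_in_iff)
    then show ?thesis by (auto simp: Suc_le_eq intro!: gr0I)
  qed
  have V: "finite ?V" "?V \<noteq> {}" using k by auto
  note N = card_multiset_corners[OF V finP ideal singles PV cP s]
  have "corners \<subseteq> count ` ?N"
  proof
    fix a assume a: "a \<in> corners"
    then obtain M where M: "a = count M" "set_mset M \<subseteq> {..<k}"
      using nvecs_count by (auto simp: corners_def)
    have a0: "count M 0 = 0" using corner_0[OF a] M by simp
    then have "0 \<notin># M" by (simp add: not_in_iff)
    then have "set_mset M \<subseteq> ?V" using M(2) by (auto simp: Suc_le_eq intro!: gr0I)
    moreover have "M - {#v#} \<in> ?P" if "v \<in># M" for v
      using that a a0 unfolding M(1) corners_def by (auto simp: count_decrement)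
    ultimately show "a \<in> count ` ?N" using a M by (auto simp: corners_def)
  qed
  then show "finite corners" using N(1) by (meson finite_imageI finite_subset)
  have "card corners \<le> card ?N"
    using \<open>corners \<subseteq> count ` ?N\<close> N(1) by (meson card_image_le card_mono finite_imageI le_trans)
  then show "card corners + s \<le> (k choose 2) + growth s" using N(2) k by simp
qed

lemma rho_witness:
  assumes "finite corners"
  obtains X where "rho \<Gamma> = card X" "finite X" "minimal_generating X" "card X \<le> card corners"
proof -
  obtain Y where Y: "monoid_congruence k hull Y = kernel" "finite Y" "card Y \<le> card corners"
    using corners_generate assms by blast
  let ?X = "SOME X. min_relations \<Gamma> X"
  have X: "minimal_generating ?X"
    using someI_ex[OF minimal_generating_exists[OF Y(2,1)]] by (simp add: min_relations_eq)
  show ?thesis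
    using that[of ?X] X minimal_generating_card_le[OF X Y(2,1)] Y(3) by (simp add: rho_def)
qed

text \<open>\<open>facets\<close> isolates \<open>M\<close>: a factorization sharing the variable
  \<open>v\<close> with it becomes, after cancelling \<open>v\<close>, a factorization of the facet.
  \<open>redundant\<close> supplies a base point, a factorization through variable 0, which no
  element of \<open>A\<close> contains.\<close>

lemma card_isolated_multisets_le_rho:
  assumes corners: "finite corners" and A: "finite A"
    and V: "\<And>M. M \<in> A \<Longrightarrow> set_mset M \<subseteq> {1..<k}"
    and facets: "\<And>M v a. M \<in> A \<Longrightarrow> v \<in># M \<Longrightarrow> a \<in> nvecs k \<Longrightarrow> deg a = deg (count (M - {#v#})) \<Longrightarrow>
      a = count (M - {#v#})"
    and redundant: "\<And>M. M \<in> A \<Longrightarrow> \<exists>n\<in>\<Gamma>. deg (count M) = n + Defs.mult \<Gamma>"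
  shows "card A \<le> rho \<Gamma>"
proof -
  obtain X where X: "rho \<Gamma> = card X" "finite X" "minimal_generating X"
    by (rule rho_witness[OF corners])
  have V': "count M \<in> nvecs k" if "M \<in> A" for M
    unfolding count_nvecs using V[OF that] by (auto dest: subsetD)
  have "card (count ` A) \<le> card X"
  proof (rule card_isolated_le[OF _ X(2)])
    show "monoid_congruence k hull X = kernel" using X(3) by (simp add: minimal_generating_def)
    fix a assume "a \<in> count ` A"
    then obtain M where M: "M \<in> A" "a = count M" by auto
    show "b = a" if ab_linked: "(a, b) \<in> linked" for b
    proof -
      obtain i where i: "0 < a i" "0 < b i" and ab: "(a, b) \<in> kernel"
        using ab_linked by (auto simp: linked_def)
      have iM: "i \<in># M" using i M by simp
      have nv: "a \<in> nvecs k" "b \<in> nvecs k" "deg a = deg b" using ab by (auto simp: kernel_def)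
      have "deg (b(i := b i - 1)) = deg (a(i := a i - 1))"
        using deg_decrement[OF nv(1) i(1)] deg_decrement[OF nv(2) i(2)] nv(3) by simp
      then have "b(i := b i - 1) = a(i := a i - 1)"
        using facets[OF M(1) iM decrement_nvecs[OF nv(2), of i]] M(2) by (simp only: count_decrement)
      then show "b = a"
        using decrement_add[of a i, OF i(1)] decrement_add[of b i, OF i(2)] by simp
    qed
    obtain n where n: "n \<in> \<Gamma>" "deg a = n + Defs.mult \<Gamma>" using redundant M by blast
    then obtain c where c: "c \<in> nvecs k" "deg c = n" using deg_surj by blast
    let ?b = "\<lambda>i. c i + unit_vec 0 i"
    have "?b \<in> nvecs k" "deg ?b = deg a"
      using c n add_nvecs unit_vec_nvecs[OF k_pos] by (auto simp: deg_add deg_unit_vec[OF k_pos] gen_0)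
    then have "(a, ?b) \<in> kernel" using V' M by (simp add: kernel_def)
    moreover have "?b \<notin> count ` A"
    proof
      assume "?b \<in> count ` A"
      then obtain M' where "M' \<in> A" "?b = count M'" by auto
      moreover from this have "0 \<in># M'" by (metis add_gr_0 count_greater_zero_iff unit_vec_simps(1) zero_less_one)
      ultimately show False using V by fastforce
    qed
    ultimately show "\<exists>b. b \<notin> count ` A \<and> (a, b) \<in> kernel" by blast
  qed (use A in auto)
  moreover have "card (count ` A) = card A"
    by (intro card_image) (auto simp: inj_on_def count_inject)
  ultimately show ?thesis using X by simp
qed

end

section \<open>Macaulay bounds and extremal monoids\<close>

lemma macaulay_up_2:
  assumes "n \<le> 5" shows "macaulay_up n 2 = growth n"
proof (cases "n = 0")
  case True
  then show ?thesis by (simp add: macaulay_up_def growth_def)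
next
  case False
  have sums: "(\<Sum>i=Suc 0..2. f i) = f 1 + f 2" "(\<Sum>i=2..2. f i) = f 2" for f :: "nat \<Rightarrow> nat"
    by (simp_all add: numeral_2_eq_2)
  have "(THE v. \<exists>j c. macaulay_expansion n 2 j c \<and> v = (\<Sum>i=j..2. (c i + 1) choose (i + 1))) = growth n"
  proof (rule the_equality)
    \<comment> \<open>Expansions: 1 = C(2,2), 2 = C(2,2) + C(1,1), 3 = C(3,2), 4 = C(3,2) + C(1,1),
      5 = C(3,2) + C(2,1).\<close>
    have "n \<in> {1, 2, 3, 4, 5}" using False assms by auto
    then consider "n = 1" | "n = 2" | "n = 3" | "n = 4" | "n = 5" by auto
    then show "\<exists>j c. macaulay_expansion n 2 j c \<and> growth n = (\<Sum>i=j..2. (c i + 1) choose (i + 1))"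
    proof cases
      case 1
      then show ?thesis
        by (intro exI[of _ 2] exI[of _ "\<lambda>_. 2"]) (simp add: macaulay_expansion_def sums growth_def)
    next
      case 2
      then show ?thesis
        by (intro exI[of _ 1] exI[of _ "\<lambda>i. i"]) (simp add: macaulay_expansion_def sums growth_def)
    next
      case 3
      then show ?thesis
        by (intro exI[of _ 2] exI[of _ "\<lambda>_. 3"])
          (simp add: macaulay_expansion_def sums growth_def numeral_eq_Suc)
    next
      case 4
      then show ?thesis
        by (intro exI[of _ 1] exI[of _ "\<lambda>i. if i = 1 then 1 else 3"])
          (simp add: macaulay_expansion_def sums growth_def numeral_eq_Suc)
    next
      case 5
      then show ?thesis
        by (intro exI[of _ 1] exI[of _ "\<lambda>i. i + 1"])
          (simp add: macaulay_expansion_def sums growth_def numeral_eq_Suc)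
    qed
  next
    fix v assume "\<exists>j c. macaulay_expansion n 2 j c \<and> v = (\<Sum>i=j..2. (c i + 1) choose (i + 1))"
    then obtain j c where jc: "1 \<le> j" "j \<le> 2" "j \<le> c j" "\<forall>i\<in>{j..<2}. c i < c (Suc i)"
      "n = (\<Sum>i=j..2. c i choose i)" "v = (\<Sum>i=j..2. (c i + 1) choose (i + 1))"
      by (auto simp: macaulay_expansion_def)
    have c2: "c 2 \<le> 3"
    proof (rule ccontr)
      assume "\<not> c 2 \<le> 3"
      then have "(4 choose 2) \<le> (c 2 choose 2)" by (intro binomial_right_mono) auto
      moreover have "(4 choose 2) = (6 :: nat)" by (simp add: choose_two)
      moreover have "(c 2 choose 2) \<le> n"
        unfolding jc(5) using jc(2) by (intro member_le_sum) auto
      ultimately show False using assms by simp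
    qed
    from jc(1,2) consider "j = 1" | "j = 2" by linarith
    then show "v = growth n"
    proof cases
      case 1
      then have "1 \<le> c 1" "c 1 < c 2" using jc by (auto simp: numeral_2_eq_2)
      then consider "c 1 = 1" "c 2 = 2" | "c 1 = 1" "c 2 = 3" | "c 1 = 2" "c 2 = 3"
        using c2 by linarith
      then show ?thesis using jc(5,6) 1
        by cases (simp_all add: sums growth_def numeral_eq_Suc)
    next
      case 2
      then consider "c 2 = 2" | "c 2 = 3" using c2 jc by fastforce
      then show ?thesis using jc(5,6) 2
        by cases (simp_all add: sums growth_def numeral_eq_Suc)
    qed
  qed
  then show ?thesis using False by (simp add: macaulay_up_def)
qed

lemma bound_index_2:
  assumes "e + 1 \<le> m" "m < (e + 2) choose 2"
  shows "bound_index e m = 2"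
  unfolding bound_index_def
proof (rule the_equality)
  show "1 \<le> (2::nat) \<and> ((e + 2 - 1) choose (2 - 1)) \<le> m \<and> m < ((e + 2) choose 2)"
    using assms by simp
next
  fix r assume r: "1 \<le> r \<and> ((e + r - 1) choose (r - 1)) \<le> m \<and> m < ((e + r) choose r)"
  have "r \<noteq> 1" using r assms by auto
  moreover have "\<not> 3 \<le> r"
  proof
    assume "3 \<le> r"
    then obtain q where q: "r = q + 3" by (metis add.commute le_Suc_ex)
    \<comment> \<open>Written with lower index \<open>e\<close>, the coefficients for different
      \<open>r\<close> differ only in the upper index and are monotone there.\<close>
    have "(e + 2) choose e \<le> (e + 2 + q) choose e" by (intro binomial_right_mono) simp
    moreover have "(e + 2) choose e = (e + 2) choose 2"
      using binomial_symmetric[of 2 "e + 2"] by simp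
    moreover have "(e + 2 + q) choose e = (e + r - 1) choose (r - 1)"
      using binomial_symmetric[of e "e + 2 + q"] q by (simp add: algebra_simps)
    ultimately show False using r assms by simp
  qed
  ultimately show "r = 2" using r by simp
qed

text \<open>\<open>e \<ge> 3\<close> gives \<open>(e + 1) choose 2 \<ge> 6 > s\<close>, which keeps
  \<open>m\<close> below \<open>(e + 2) choose 2\<close> and so fixes the index 2.\<close>

lemma macaulay_bound_eq:
  assumes "3 \<le> e" "m = e + 1 + s" "s \<le> 5"
  shows "macaulay_bound e m + s = ((e + 1) choose 2) + growth s"
proof -
  have "(e + 2) choose 2 = ((e + 1) choose 2) + (e + 1)" by (simp add: numeral_2_eq_2)
  moreover have "(4 choose 2) \<le> (e + 1) choose 2" using assms by (intro binomial_right_mono) auto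
  ultimately have "m < (e + 2) choose 2" using assms by (simp add: choose_two)
  then have "bound_index e m = 2" using assms by (intro bound_index_2) auto
  moreover have "s \<le> growth s" using assms by (auto simp: growth_def)
  ultimately show ?thesis
    using assms by (simp add: macaulay_bound_def macaulay_up_2)
qed

section \<open>An extremal monoid, built from its Apery set\<close>

locale extremal_monoid =
  fixes m s :: nat
  assumes m: "4 + s \<le> m" and s: "s \<le> 5"
begin

text \<open>Residues of \<open>2x\<close>, \<open>x + y\<close>, \<open>2y\<close>,
  \<open>x + z\<close>, \<open>2z\<close> in this order. The locale assumption
  \<open>4 + s \<le> m\<close>, which is \<open>e \<ge> 3\<close> for \<open>e + 1 = m - s\<close>,
  keeps those in use distinct from each other and from the residues of \<open>x\<close>,
  \<open>y\<close> and, for \<open>s \<ge> 4\<close>, \<open>z\<close>.\<close>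

definition decomposable :: "nat \<Rightarrow> bool" where
  "decomposable i \<longleftrightarrow> 1 \<le> s \<and> i = 4 \<or> 2 \<le> s \<and> i = 5 \<or> 3 \<le> s \<and> i = 6 \<or>
     4 \<le> s \<and> i = 1 \<or> 5 \<le> s \<and> i = m - 2"

text \<open>The Apery set: with \<open>x = 3m + 2\<close>, \<open>y = 3m + 3\<close> and (if \<open>s \<ge> 4\<close>) \<open>z = 4m - 1\<close>, its decomposable
  elements are the first \<open>s\<close> of \<open>2x\<close>, \<open>x + y\<close>, \<open>2y\<close>, \<open>x + z\<close>, \<open>2z\<close>; the remaining residues are filled
  with generators too large to interfere.\<close>

definition apery :: "nat \<Rightarrow> nat" where
  "apery i = (if i = 0 then 0 else if i = 2 \<or> i = 3 \<or> 4 \<le> s \<and> i = m - 1 then 3 * m + i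
     else if 1 \<le> s \<and> i = 4 \<or> 2 \<le> s \<and> i = 5 \<or> 3 \<le> s \<and> i = 6 then 6 * m + i
     else if 4 \<le> s \<and> i = 1 \<or> 5 \<le> s \<and> i = m - 2 then 7 * m + i else 5 * m + i)"

text \<open>Prescribes the least element of each residue class; closure under addition then amounts
  to subadditivity of \<open>apery\<close>.\<close>

definition \<Gamma> :: "nat set" where
  "\<Gamma> = {n. apery (n mod m) \<le> n}"

lemma apery_0: "apery 0 = 0"
  by (simp add: apery_def)

lemma apery_mod:
  assumes "i < m" shows "apery i mod m = i"
proof -
  have "\<exists>c. apery i = i + c * m"
    unfolding apery_def by (cases "i = 0") (auto simp: add.commute intro: exI[of _ 3] exI[of _ 5] exI[of _ 6] exI[of _ 7])
  then show ?thesis using assms by auto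
qed

lemma apery_ge: "0 < i \<Longrightarrow> 3 * m + i \<le> apery i"
  "0 < i \<Longrightarrow> i \<noteq> 2 \<Longrightarrow> i \<noteq> 3 \<Longrightarrow> i \<noteq> m - 1 \<Longrightarrow> 5 * m + i \<le> apery i"
  by (auto simp: apery_def)

lemma apery_le: "apery i \<le> 7 * m + i"
  "i \<noteq> 1 \<Longrightarrow> s < 5 \<or> i \<noteq> m - 2 \<Longrightarrow> apery i \<le> 6 * m + i"
  "\<not> decomposable i \<Longrightarrow> apery i \<le> 5 * m + i"
  by (auto simp: apery_def decomposable_def)

text \<open>Two nonzero residues contribute at least \<open>6 * m + i + j\<close>. With a carry,
  \<open>7 * m\<close> plus the residue is no more than that. Without one, the only sum lying above
  \<open>6 * m\<close> plus its residue is \<open>m - 2\<close> for \<open>s = 5\<close>, and then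
  one summand is a residue from 4 to \<open>m - 3\<close>, hence at least
  \<open>5 * m\<close>.\<close>

lemma apery_subadditive:
  assumes "i < m" "j < m"
  shows "apery ((i + j) mod m) \<le> apery i + apery j"
proof (cases "i = 0 \<or> j = 0")
  case True
  then show ?thesis using assms by auto
next
  case False
  then have ge: "3 * m + i \<le> apery i" "3 * m + j \<le> apery j" using apery_ge by auto
  show ?thesis
  proof (cases "i + j < m")
    case True
    have "apery (i + j) \<le> apery i + apery j"
    proof (cases "s < 5 \<or> i + j \<noteq> m - 2")
      case True
      then show ?thesis using apery_le(2)[of "i + j"] ge False by linarith
    next
      case F: False
      then have s5: "s = 5" "9 \<le> m" "i + j = m - 2" using s m by auto
      then have "i \<noteq> 2 \<and> i \<noteq> 3 \<and> i \<noteq> m - 1 \<or> j \<noteq> 2 \<and> j \<noteq> 3 \<and> j \<noteq> m - 1"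
      proof -
        have "i \<noteq> m - 1" "j \<noteq> m - 1" using s5 by linarith+
        moreover have "4 \<le> i \<or> 4 \<le> j" using s5 by linarith
        ultimately show ?thesis by auto
      qed
      then have "5 * m + i \<le> apery i \<or> 5 * m + j \<le> apery j" using apery_ge(2)[of i] apery_ge(2)[of j] False by blast
      then show ?thesis using apery_le(1)[of "i + j"] ge by linarith
    qed
    then show ?thesis using True by simp
  next
    case False
    then have "(i + j) mod m = i + j - m" using assms by (simp add: mod_if)
    then have "apery ((i + j) mod m) \<le> 7 * m + (i + j - m)" using apery_le(1) by simp
    then show ?thesis using ge False by linarith
  qed
qed

lemma submonoid: "add_submonoid \<Gamma>"
  unfolding add_submonoid_def
proof (intro conjI ballI)
  show "0 \<in> \<Gamma>" by (simp add: \<Gamma>_def apery_def)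
  fix a b assume ab: "a \<in> \<Gamma>" "b \<in> \<Gamma>"
  have "apery ((a mod m + b mod m) mod m) \<le> apery (a mod m) + apery (b mod m)"
    using m by (intro apery_subadditive) auto
  then show "a + b \<in> \<Gamma>" using ab by (simp add: \<Gamma>_def mod_add_eq)
qed

lemma numerical: "numerical_monoid \<Gamma>"
proof -
  have "UNIV - \<Gamma> \<subseteq> {..<8 * m}"
  proof
    fix n assume "n \<in> UNIV - \<Gamma>"
    then have "n < apery (n mod m)" by (simp add: \<Gamma>_def)
    moreover have "n mod m < m" using m by simp
    ultimately show "n \<in> {..<8 * m}" using apery_le(1)[of "n mod m"] by simp
  qed
  then show ?thesis
    using submonoid finite_subset by (auto simp: numerical_monoid_def)
qed

lemma apery_mem: "i < m \<Longrightarrow> apery i \<in> \<Gamma>"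
  by (simp add: \<Gamma>_def apery_mod)

lemma apery_or_shift:
  assumes "n \<in> \<Gamma>"
  shows "n = apery (n mod m) \<or> (\<exists>n'\<in>\<Gamma>. n = n' + m)"
proof (cases "n = apery (n mod m)")
  case False
  let ?w = "apery (n mod m)"
  have lt: "?w < n" using assms False by (simp add: \<Gamma>_def)
  have "?w mod m = n mod m" using m by (intro apery_mod) simp
  then have "m dvd n - ?w" using lt by (metis mod_eq_dvd_iff_nat less_imp_le)
  then have le: "?w + m \<le> n" using lt by (metis add.commute dvd_imp_le le_diff_conv2 less_imp_le zero_less_diff)
  then have "(n - m) mod m = n mod m" by (metis add_leE le_mod_geq)
  then have "n - m \<in> \<Gamma>" using le by (simp add: \<Gamma>_def)
  then show ?thesis using le by (intro disjI2 bexI[of _ "n - m"]) auto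
qed simp

lemma mem_ge:
  assumes "n \<in> \<Gamma>" "n \<noteq> 0" shows "m \<le> n" and "n mod m \<noteq> 0 \<Longrightarrow> 3 * m + 1 \<le> n"
proof -
  show "3 * m + 1 \<le> n" if "n mod m \<noteq> 0"
    using assms apery_ge(1)[of "n mod m"] that by (simp add: \<Gamma>_def)
  then show "m \<le> n" using assms by (cases "n mod m = 0") (auto simp: dvd_imp_le mod_eq_0_iff_dvd)
qed

section \<open>Minimal generators of the extremal monoid\<close>

definition generators :: "nat set" where
  "generators = insert m (apery ` {i. 0 < i \<and> i < m \<and> \<not> decomposable i})"

lemma decomposable_apery:
  assumes "decomposable i"
  shows "\<exists>a\<in>\<Gamma>. \<exists>b\<in>\<Gamma>. a \<noteq> 0 \<and> b \<noteq> 0 \<and> apery i = a + b"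
proof -
  have x: "3 * m + 2 \<in> \<Gamma>" using apery_mem[of 2] m by (simp add: apery_def)
  have y: "3 * m + 3 \<in> \<Gamma>" using apery_mem[of 3] m by (simp add: apery_def)
  have z: "4 \<le> s \<Longrightarrow> 4 * m - 1 \<in> \<Gamma>" using apery_mem[of "m - 1"] m by (simp add: apery_def)
  consider "i = 4" "1 \<le> s" | "i = 5" "2 \<le> s" | "i = 6" "3 \<le> s" | "i = 1" "4 \<le> s" | "i = m - 2" "5 \<le> s"
    using assms by (auto simp: decomposable_def)
  then show ?thesis
  proof cases
    case 1
    then show ?thesis using x m by (intro bexI[OF _ x] bexI[OF _ x]) (auto simp: apery_def)
  next
    case 2
    then show ?thesis using m by (intro bexI[OF _ x] bexI[OF _ y]) (auto simp: apery_def)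
  next
    case 3
    then show ?thesis using m by (intro bexI[OF _ y] bexI[OF _ y]) (auto simp: apery_def)
  next
    case 4
    then show ?thesis using m by (intro bexI[OF _ x] bexI[OF _ z]) (auto simp: apery_def)
  next
    case 5
    then have "apery i = 8 * m - 2" using m by (auto simp: apery_def; linarith)
    then show ?thesis using 5 z m by (intro bexI[of _ "4 * m - 1"]) auto
  qed
qed

text \<open>A generator is below \<open>6 * m\<close>, so it is no sum of two elements that are not
  multiples of \<open>m\<close>, each being at least \<open>3 * m + 1\<close>. If one summand is a
  multiple of \<open>m\<close>, the other has the residue of the sum and is already at least its
  Apery element.\<close>

lemma irreducibles_eq: "irreducibles \<Gamma> = generators"
proof
  show "irreducibles \<Gamma> \<subseteq> generators"
  proof
    fix n assume n: "n \<in> irreducibles \<Gamma>"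
    then have irr: "n \<in> \<Gamma>" "n \<noteq> 0" "\<And>a b. a \<in> \<Gamma> \<Longrightarrow> b \<in> \<Gamma> \<Longrightarrow> n = a + b \<Longrightarrow> a = 0 \<or> b = 0"
      by (auto simp: irreducibles_def)
    have mG: "m \<in> \<Gamma>" by (simp add: \<Gamma>_def apery_def)
    from apery_or_shift[OF irr(1)] show "n \<in> generators"
    proof
      assume w: "n = apery (n mod m)"
      have "n mod m \<noteq> 0" using w irr(2) apery_0 by metis
      moreover have "\<not> decomposable (n mod m)"
        using decomposable_apery[of "n mod m"] w irr(3) by metis
      ultimately show ?thesis using w m by (auto simp: generators_def)
    next
      assume "\<exists>n'\<in>\<Gamma>. n = n' + m"
      then obtain n' where "n' \<in> \<Gamma>" "n = n' + m" by blast
      then have "n = m" using irr(3)[of n' m] mG m by auto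
      then show ?thesis by (simp add: generators_def)
    qed
  qed
  show "generators \<subseteq> irreducibles \<Gamma>"
  proof
    fix n assume n: "n \<in> generators"
    have nG: "n \<in> \<Gamma> \<and> n \<noteq> 0"
    proof (cases "n = m")
      case True
      then show ?thesis using m by (simp add: \<Gamma>_def apery_0)
    next
      case False
      then obtain i where "0 < i" "i < m" "n = apery i" using n by (auto simp: generators_def)
      then show ?thesis using apery_mem[of i] apery_ge(1)[of i] by simp
    qed
    have "a = 0 \<or> b = 0" if ab: "a \<in> \<Gamma>" "b \<in> \<Gamma>" "n = a + b" for a b
    proof (rule ccontr)
      assume "\<not> ?thesis"
      then have nz: "a \<noteq> 0" "b \<noteq> 0" by auto
      have ge: "m \<le> a" "m \<le> b" using mem_ge(1) ab nz by auto
      show False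
      proof (cases "n = m")
        case True
        then show False using ge ab m by simp
      next
        case False
        then obtain i where i: "0 < i" "i < m" "\<not> decomposable i" "n = apery i"
          using n by (auto simp: generators_def)
        have lt: "n < 6 * m" using apery_le(3)[OF i(3)] i by simp
        have ni: "n mod m = i" using i apery_mod by simp
        consider "a mod m = 0" | "b mod m = 0" | "a mod m \<noteq> 0" "b mod m \<noteq> 0" by blast
        then show False
        proof cases
          case 1
          then have "b mod m = i" using ab(3) ni by (metis mod_add_left_eq add_0)
          then have "n \<le> b" using ab(2) i(4) by (simp add: \<Gamma>_def)
          then show False using ab(3) nz by simp
        next
          case 2
          then have "a mod m = i" using ab(3) ni by (metis mod_add_right_eq add_0_right)
          then have "n \<le> a" using ab(1) i(4) by (simp add: \<Gamma>_def)
          then show False using ab(3) nz by simp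
        next
          case 3
          then show False using mem_ge(2)[OF ab(1) nz(1)] mem_ge(2)[OF ab(2) nz(2)] ab(3) lt by simp
        qed
      qed
    qed
    then show "n \<in> irreducibles \<Gamma>" using nG by (auto simp: irreducibles_def)
  qed
qed

lemma card_generators: "finite generators" "card generators = m - s"
proof -
  let ?D = "{i. 0 < i \<and> i < m \<and> decomposable i}" and ?G = "{i. 0 < i \<and> i < m \<and> \<not> decomposable i}"
  have finG: "finite ?G" by simp
  then show "finite generators" by (simp add: generators_def)
  have D: "?D = (if 1 \<le> s then {4} else {}) \<union> (if 2 \<le> s then {5} else {}) \<union>
      (if 3 \<le> s then {6} else {}) \<union> (if 4 \<le> s then {1} else {}) \<union> (if 5 \<le> s then {m - 2} else {})"
    using m by (auto simp: decomposable_def)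
  have s_cases: "s = 0 \<or> s = 1 \<or> s = 2 \<or> s = 3 \<or> s = 4 \<or> s = 5" using s by linarith
  have "card ?D = s"
  proof (cases "s = 5")
    case True
    \<comment> \<open>For \<open>s = 5\<close>, \<open>m \<ge> 9\<close> separates
      \<open>m - 2\<close> from the other four residues.\<close>
    have "card {4, 5, 6, 1, m - 2} = 5" using m True by simp
    then show ?thesis unfolding D using True by (simp add: insert_commute)
  next
    case False
    then show ?thesis unfolding D using s_cases by auto
  qed
  moreover have "?G = {0<..<m} - ?D" by auto
  ultimately have cG: "card ?G = m - 1 - s" proof -
    assume D: "card ?D = s" and G: "?G = {0<..<m} - ?D"
    have "?D \<subseteq> {0<..<m}" by auto
    then show ?thesis unfolding G using D by (subst card_Diff_subset) auto
  qed
  have "inj_on apery ?G"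
    by (rule inj_on_inverseI[of _ "\<lambda>n. n mod m"]) (simp add: apery_mod)
  then have "card (apery ` ?G) = m - 1 - s" using cG by (simp add: card_image)
  moreover have "m \<notin> apery ` ?G"
  proof
    assume "m \<in> apery ` ?G"
    then obtain i where "0 < i" "i < m" "m = apery i" by blast
    then show False using apery_mod[of i] by simp
  qed
  ultimately show "card generators = m - s" unfolding generators_def using finG m by simp
qed

lemma mult_eq: "Defs.mult \<Gamma> = m"
  unfolding Defs.mult_def min_gens_eq_irreducibles[OF submonoid]
proof (rule Min_eqI)
  show "finite (irreducibles \<Gamma>)" using card_generators irreducibles_eq by simp
  show "m \<le> y" if "y \<in> irreducibles \<Gamma>" for y
    using that mem_ge(1) by (auto simp: irreducibles_def)
  show "m \<in> irreducibles \<Gamma>" by (simp add: irreducibles_eq generators_def)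
qed

sublocale generated_monoid \<Gamma> "m - s"
  by standard (use submonoid card_generators irreducibles_eq m in auto)

section \<open>Decomposable Apery elements and their factorizations\<close>

definition W :: "nat set" where
  "W = (if 1 \<le> s then {6 * m + 4} else {}) \<union> (if 2 \<le> s then {6 * m + 5} else {}) \<union>
    (if 3 \<le> s then {6 * m + 6} else {}) \<union> (if 4 \<le> s then {7 * m + 1} else {}) \<union>
    (if 5 \<le> s then {8 * m - 2} else {})"

lemma W_iff: "w \<in> W \<longleftrightarrow> 1 \<le> s \<and> w = 6 * m + 4 \<or> 2 \<le> s \<and> w = 6 * m + 5 \<or>
    3 \<le> s \<and> w = 6 * m + 6 \<or> 4 \<le> s \<and> w = 7 * m + 1 \<or> 5 \<le> s \<and> w = 8 * m - 2"
  by (auto simp: W_def)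

lemma W_eq: "W = apery ` {i. decomposable i}"
proof -
  have a: "1 \<le> s \<Longrightarrow> apery 4 = 6 * m + 4" "2 \<le> s \<Longrightarrow> apery 5 = 6 * m + 5"
    "3 \<le> s \<Longrightarrow> apery 6 = 6 * m + 6" "4 \<le> s \<Longrightarrow> apery 1 = 7 * m + 1"
    using m by (auto simp: apery_def)
  have a5: "apery (m - 2) = 8 * m - 2" if "5 \<le> s"
    using m that by (auto simp: apery_def; linarith)
  have "{i. decomposable i} = (if 1 \<le> s then {4} else {}) \<union> (if 2 \<le> s then {5} else {}) \<union>
      (if 3 \<le> s then {6} else {}) \<union> (if 4 \<le> s then {1} else {}) \<union> (if 5 \<le> s then {m - 2} else {})"
    by (auto simp: decomposable_def)
  then show ?thesis unfolding W_def using a a5 by (simp add: image_Un)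
qed

lemma card_W: "finite W" "card W \<le> s"
proof -
  show "finite W" by (simp add: W_def)
  have "s = 0 \<or> s = 1 \<or> s = 2 \<or> s = 3 \<or> s = 4 \<or> s = 5" using s by linarith
  then show "card W \<le> s" unfolding W_def
    by (elim disjE) (simp_all add: card_insert_if)
qed

lemma W_le: "w \<in> W \<Longrightarrow> w \<le> 8 * m - 2"
  using m by (auto simp: W_iff)

text \<open>The six sums of two elements of \<open>{x, y, z}\<close> are distinct, and heavier generators
  overshoot \<open>W\<close>.\<close>

lemma W_unique_pair:
  assumes "u \<in> generators - {m}" "v \<in> generators - {m}" "u' \<in> generators - {m}" "v' \<in> generators - {m}"
    and "u + v \<in> W" "u' + v' = u + v"
  shows "u = u' \<and> v = v' \<or> u = v' \<and> v = u'"
proof -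
  have heavy: "u = 3 * m + 2 \<or> u = 3 * m + 3 \<or> 4 \<le> s \<and> u = 4 * m - 1 \<or> 5 * m + 1 \<le> u"
    if u: "u \<in> generators - {m}" for u
  proof -
    obtain i where i: "0 < i" "u = apery i" using u by (auto simp: generators_def)
    then have "i = 2 \<or> i = 3 \<or> 4 \<le> s \<and> i = m - 1 \<or> 5 * m + i \<le> apery i" by (simp add: apery_def)
    moreover have "i = 2 \<Longrightarrow> u = 3 * m + 2" "i = 3 \<Longrightarrow> u = 3 * m + 3" using i by (auto simp: apery_def)
    moreover have "4 \<le> s \<Longrightarrow> i = m - 1 \<Longrightarrow> u = 4 * m - 1" using i m by (simp add: apery_def)
    ultimately show ?thesis using i by linarith
  qed
  have ge: "3 * m + 2 \<le> u" if "u \<in> generators - {m}" for u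
    using heavy[OF that] m by linarith
  have light: "u = 3 * m + 2 \<or> u = 3 * m + 3 \<or> 4 \<le> s \<and> u = 4 * m - 1"
    if "u \<in> generators - {m}" "v \<in> generators - {m}" "u + v \<in> W" for u v
    using heavy[OF that(1)] ge[OF that(2)] W_le[OF that(3)] m by linarith
  have "v + u \<in> W" "u' + v' \<in> W" "v' + u' \<in> W"
    using assms(5,6) by (simp_all add: add.commute)
  note cases = light[OF assms(1,2,5)] light[OF assms(2,1) this(1)]
    light[OF assms(3,4) this(2)] light[OF assms(4,3) this(3)]
  define z where "z = 4 * m - 1"
  have z: "z + 1 = 4 * m" using m by (simp add: z_def)
  show ?thesis
  proof (rule ccontr)
    assume "\<not> ?thesis"
    then have ne: "u \<noteq> u'" "u \<noteq> v'" using assms(6) by auto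
    have ne': "v \<noteq> u'" "v \<noteq> v'" using ne assms(6) by auto
    note cases = cases[folded z_def]
    \<comment> \<open>\<open>z\<close> occurs only for \<open>s \<ge> 4\<close>, hence
      \<open>m \<ge> 8\<close>: a pair containing \<open>z\<close> sums to at least
      \<open>7 * m + 1\<close>, a pair without it to at most \<open>6 * m + 6\<close>.\<close>
    have light': "u \<le> 3 * m + 3 \<or> u = z \<and> 8 \<le> m" "v \<le> 3 * m + 3 \<or> v = z \<and> 8 \<le> m"
      "u' \<le> 3 * m + 3 \<or> u' = z \<and> 8 \<le> m" "v' \<le> 3 * m + 3 \<or> v' = z \<and> 8 \<le> m"
      using cases m by linarith+
    have low: "3 * m + 2 \<le> u" "3 * m + 2 \<le> v" "3 * m + 2 \<le> u'" "3 * m + 2 \<le> v'"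
      using ge assms by blast+
    have "u \<le> 3 * m + 3" using light'(1,3,4) low(2) ne assms(6) z by linarith
    moreover have "v \<le> 3 * m + 3" using light'(2,3,4) low(1) ne' assms(6) z by linarith
    moreover from this and \<open>u \<le> 3 * m + 3\<close> have "u' \<le> 3 * m + 3" "v' \<le> 3 * m + 3"
      using light'(3,4) low(3,4) assms(6) z by linarith+
    ultimately show False using low ne ne' assms(6) by linarith
  qed
qed

lemma gen_generators: "0 < i \<Longrightarrow> i < m - s \<Longrightarrow> gen \<Gamma> i \<in> generators - {m}"
  using gen_irreducible[of i] gen_eq_iff[of i 0] gen_0 mult_eq irreducibles_eq by auto

lemma generators_ge: "u \<in> generators - {m} \<Longrightarrow> 3 * m + 2 \<le> u"
proof -
  assume u: "u \<in> generators - {m}"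
  then obtain i where i: "0 < i" "u = apery i" by (auto simp: generators_def)
  show ?thesis
  proof (cases "i = 1")
    case True
    moreover have "1 \<noteq> m - 1" using m by linarith
    ultimately have "5 * m + 1 \<le> apery 1" using apery_ge(2)[of 1] by simp
    then show ?thesis using i True m by simp
  next
    case False
    then show ?thesis using apery_ge(1)[of i] i by simp
  qed
qed

text \<open>Variable 0 is excluded because an Apery element is least in its residue class. Three
  factors reach \<open>9 * m + 6\<close>, beyond all of \<open>W\<close>, and a single factor would
  be irreducible.\<close>

lemma W_factorization:
  assumes M: "set_mset M \<subseteq> {..<m - s}" and W: "(\<Sum>i\<in>#M. gen \<Gamma> i) \<in> W"
  obtains p q where "M = {#p, q#}" "0 < p" "0 < q"
proof -
  obtain i where i: "decomposable i" "(\<Sum>i\<in>#M. gen \<Gamma> i) = apery i" using W by (auto simp: W_eq)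
  have im: "0 < i" "i < m" using i(1) m by (auto simp: decomposable_def)
  have "0 \<notin># M"
  proof
    assume "0 \<in># M"
    then obtain N where N: "M = add_mset 0 N" by (blast dest: multi_member_split)
    have eq: "apery i = m + deg (count N)"
      using i(2) N M by (simp add: deg_count gen_0 mult_eq)
    have "deg (count N) mod m = i" using apery_mod[OF im(2)] eq by simp
    then have "apery i \<le> deg (count N)" using deg_mem[of "count N"] by (simp add: \<Gamma>_def)
    then show False using eq m by simp
  qed
  then have pos: "0 < j" if "j \<in># M" for j using that by (auto intro!: gr0I)
  have gens: "gen \<Gamma> j \<in> generators - {m}" if "j \<in># M" for j
    using that pos[OF that] M by (intro gen_generators) auto
  have size_le: "size N * (3 * m + 2) \<le> (\<Sum>i\<in>#N. gen \<Gamma> i)" if "N \<subseteq># M" for N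
    using that
  proof (induction N)
    case (add j N)
    then have "3 * m + 2 \<le> gen \<Gamma> j" using gens generators_ge by (meson mset_subset_eq_insertD)
    moreover have "N \<subseteq># M" using add.prems by (meson mset_subset_eq_insertD subset_mset.less_imp_le)
    ultimately show ?case using add.IH by simp
  qed simp
  have le: "size M * (3 * m + 2) \<le> apery i" using size_le[of M] i(2) by simp
  have "\<not> 3 \<le> size M"
  proof
    assume "3 \<le> size M"
    then have "3 * (3 * m + 2) \<le> size M * (3 * m + 2)" by (rule mult_le_mono1)
    then show False using le W_le[OF W] i(2) by simp
  qed
  moreover have "size M \<noteq> 0" using i(2) apery_ge(1)[OF im(1)] im by auto
  moreover have "size M \<noteq> 1"
  proof
    assume "size M = 1"
    then obtain p where p: "M = {#p#}" using size_1_singleton_mset by blast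
    then have "apery i \<in> irreducibles \<Gamma>" using i(2) gens[of p] irreducibles_eq by simp
    then show False using decomposable_apery[OF i(1)] by (auto simp: irreducibles_def)
  qed
  ultimately have "size M = 2" by linarith
  then obtain p q where "M = {#p, q#}" by (rule size_eq_2E)
  then show ?thesis using that pos by simp
qed

lemma W_unique_factorization:
  assumes M: "set_mset M \<subseteq> {..<m - s}" and N: "set_mset N \<subseteq> {..<m - s}"
    and W: "(\<Sum>i\<in>#M. gen \<Gamma> i) \<in> W" and eq: "(\<Sum>i\<in>#N. gen \<Gamma> i) = (\<Sum>i\<in>#M. gen \<Gamma> i)"
  shows "N = M"
proof -
  obtain p q where pq: "M = {#p, q#}" "0 < p" "0 < q" by (rule W_factorization[OF M W])
  obtain p' q' where pq': "N = {#p', q'#}" "0 < p'" "0 < q'"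
    using W_factorization[OF N] W eq by metis
  have lt: "p < m - s" "q < m - s" "p' < m - s" "q' < m - s" using M N pq pq' by auto
  have "gen \<Gamma> p = gen \<Gamma> p' \<and> gen \<Gamma> q = gen \<Gamma> q' \<or> gen \<Gamma> p = gen \<Gamma> q' \<and> gen \<Gamma> q = gen \<Gamma> p'"
    using W eq pq pq' lt by (intro W_unique_pair gen_generators) auto
  then show ?thesis using gen_eq_iff lt pq pq' by (auto simp: add_mset_commute)
qed

lemma deg_redundant:
  assumes n: "n \<in> \<Gamma>" "n \<notin> W" "n \<notin> irreducibles \<Gamma>" "n \<noteq> 0"
  shows "\<exists>n'\<in>\<Gamma>. n = n' + m"
  using apery_or_shift[OF n(1)]
proof
  assume a: "n = apery (n mod m)"
  have "n mod m \<noteq> 0" using a n(4) apery_0 by metis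
  moreover have "\<not> decomposable (n mod m)" using a n(2) unfolding W_eq by blast
  ultimately have "n \<in> generators" using a m by (auto simp: generators_def)
  then show ?thesis using n(3) irreducibles_eq by simp
qed

text \<open>Exponents of \<open>x\<close>, \<open>y\<close>, \<open>z\<close> in the cubic monomials all of whose quadratic divisors have value in \<open>W\<close>.\<close>

definition cubics :: "(nat \<times> nat \<times> nat) set" where
  "cubics = (if 1 \<le> s then {(3, 0, 0)} else {}) \<union> (if 2 \<le> s then {(2, 1, 0)} else {}) \<union>
    (if 3 \<le> s then {(1, 2, 0), (0, 3, 0)} else {}) \<union> (if 4 \<le> s then {(2, 0, 1)} else {}) \<union>
    (if 5 \<le> s then {(1, 0, 2), (0, 0, 3)} else {})"

section \<open>Isolated monomials of the extremal monoid\<close>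

lemma card_cubics: "finite cubics" "card cubics = growth s"
proof -
  show "finite cubics" by (simp add: cubics_def)
  have "s = 0 \<or> s = 1 \<or> s = 2 \<or> s = 3 \<or> s = 4 \<or> s = 5" using s by linarith
  then show "card cubics = growth s"
    unfolding cubics_def growth_def by (elim disjE) simp_all
qed

lemma cubics_W:
  assumes "(a, b, c) \<in> cubics"
  shows "0 < a \<Longrightarrow> (a - 1) * (3 * m + 2) + b * (3 * m + 3) + c * (4 * m - 1) \<in> W"
    and "0 < b \<Longrightarrow> a * (3 * m + 2) + (b - 1) * (3 * m + 3) + c * (4 * m - 1) \<in> W"
    and "0 < c \<Longrightarrow> a * (3 * m + 2) + b * (3 * m + 3) + (c - 1) * (4 * m - 1) \<in> W"
    and "0 < c \<Longrightarrow> 4 \<le> s" and "a + b + c = 3"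
proof -
  have c: "1 \<le> s \<and> a = 3 \<and> b = 0 \<and> c = 0 \<or> 2 \<le> s \<and> a = 2 \<and> b = 1 \<and> c = 0 \<or>
      3 \<le> s \<and> a = 1 \<and> b = 2 \<and> c = 0 \<or> 3 \<le> s \<and> a = 0 \<and> b = 3 \<and> c = 0 \<or>
      4 \<le> s \<and> a = 2 \<and> b = 0 \<and> c = 1 \<or> 5 \<le> s \<and> a = 1 \<and> b = 0 \<and> c = 2 \<or>
      5 \<le> s \<and> a = 0 \<and> b = 0 \<and> c = 3"
    using assms by (auto simp: cubics_def split: if_splits)
  show "0 < c \<Longrightarrow> 4 \<le> s" "a + b + c = 3" using c by auto
  show "0 < a \<Longrightarrow> (a - 1) * (3 * m + 2) + b * (3 * m + 3) + c * (4 * m - 1) \<in> W"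
    using c m by (elim disjE conjE; simp add: W_iff; arith)
  show "0 < b \<Longrightarrow> a * (3 * m + 2) + (b - 1) * (3 * m + 3) + c * (4 * m - 1) \<in> W"
    using c m by (elim disjE conjE; simp add: W_iff; arith)
  show "0 < c \<Longrightarrow> a * (3 * m + 2) + b * (3 * m + 3) + (c - 1) * (4 * m - 1) \<in> W"
    using c m by (elim disjE conjE; simp add: W_iff; arith)
qed

lemma rho_eq: "rho \<Gamma> + s = ((m - s) choose 2) + growth s"
proof -
  let ?V = "{1..<m - s}" and ?val = "\<lambda>M. \<Sum>i\<in>#M. gen \<Gamma> i"
  have corners: "finite corners" "card corners + s \<le> ((m - s) choose 2) + growth s"
    using corners_bound[of s] mult_eq m s by auto
  have idx: "\<exists>i\<in>?V. gen \<Gamma> i = u" if u: "u \<in> generators - {m}" for u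
  proof -
    have "u \<in> gen \<Gamma> ` {..<m - s}" using u bij_gen irreducibles_eq by (auto simp: bij_betw_def)
    then obtain i where "i < m - s" "gen \<Gamma> i = u" by auto
    moreover from this have "i \<noteq> 0" using u gen_0 mult_eq by (metis DiffD2 singletonI)
    ultimately show ?thesis by auto
  qed
  have "apery 2 = 3 * m + 2" "apery 3 = 3 * m + 3" "\<not> decomposable 2" "\<not> decomposable 3"
    using m by (auto simp: apery_def decomposable_def)
  then have "3 * m + 2 \<in> generators - {m}" "3 * m + 3 \<in> generators - {m}"
    using m unfolding generators_def
    by (auto intro: image_eqI[of _ _ 2] image_eqI[of _ _ 3])
  then obtain X Y where XY: "X \<in> ?V" "gen \<Gamma> X = 3 * m + 2" "Y \<in> ?V" "gen \<Gamma> Y = 3 * m + 3"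
    using idx by meson
  have "\<exists>Z. Z \<noteq> X \<and> Z \<noteq> Y \<and> (4 \<le> s \<longrightarrow> Z \<in> ?V \<and> gen \<Gamma> Z = 4 * m - 1)"
  proof (cases "4 \<le> s")
    case True
    then have "apery (m - 1) = 4 * m - 1" "\<not> decomposable (m - 1)"
      using m by (auto simp: apery_def decomposable_def)
    then have "4 * m - 1 \<in> generators - {m}" using m True unfolding generators_def by (auto intro: image_eqI[of _ _ "m - 1"])
    then obtain Z where "Z \<in> ?V" "gen \<Gamma> Z = 4 * m - 1" using idx by meson
    then show ?thesis using XY m True by (intro exI[of _ Z]) auto
  next
    case False
    \<comment> \<open>Below \<open>s = 4\<close> no element of \<open>cubics\<close> uses
      \<open>Z\<close>; \<open>m - s\<close> is a dummy index outside \<open>?V\<close>.\<close>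
    then show ?thesis using XY by (intro exI[of _ "m - s"]) auto
  qed
  then obtain Z where Z: "Z \<noteq> X" "Z \<noteq> Y" "4 \<le> s \<Longrightarrow> Z \<in> ?V \<and> gen \<Gamma> Z = 4 * m - 1" by blast
  have ne: "X \<noteq> Y" using XY by auto
  define \<mu> where "\<mu> = (\<lambda>(a, b, c). replicate_mset a X + replicate_mset b Y + replicate_mset c Z)"
  let ?A2 = "{M. set_mset M \<subseteq> ?V \<and> size M = 2 \<and> ?val M \<notin> W}" and ?A3 = "\<mu> ` cubics"
  note Q = card_multisets_size_2[of ?V]
  have V: "set_mset M \<subseteq> ?V \<Longrightarrow> set_mset M \<subseteq> {..<m - s}" for M by auto
  have A2: "(m - s) choose 2 \<le> card ?A2 + s" "finite ?A2"
  proof -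
    \<comment> \<open>A value in \<open>W\<close> determines its monomial, so at most
      \<open>s\<close> quadratic monomials are lost.\<close>
    let ?B = "{M. set_mset M \<subseteq> ?V \<and> size M = 2 \<and> ?val M \<in> W}"
    have "inj_on ?val ?B"
      by (rule inj_onI) (use W_unique_factorization V in blast)
    then have "card ?B \<le> card W" using card_W by (intro card_inj_on_le) auto
    moreover have "{M. set_mset M \<subseteq> ?V \<and> size M = 2} = ?A2 \<union> ?B" by auto
    then have "card {M. set_mset M \<subseteq> ?V \<and> size M = 2} \<le> card ?A2 + card ?B"
      by (simp only: card_Un_le)
    moreover have "card ?V + 1 = m - s" using m by simp
    ultimately show "(m - s) choose 2 \<le> card ?A2 + s" using Q card_W by simp
    show "finite ?A2" by (rule finite_subset[OF _ Q(1)]) auto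
  qed
  have cX: "count (\<mu> (a, b, c)) X = a" "count (\<mu> (a, b, c)) Y = b" "count (\<mu> (a, b, c)) Z = c" for a b c
    using ne Z(1,2) by (simp_all add: \<mu>_def)
  have "inj_on \<mu> cubics"
    by (rule inj_on_inverseI[of _ "\<lambda>M. (count M X, count M Y, count M Z)"]) (auto simp: cX)
  then have A3: "card ?A3 = growth s" "finite ?A3" using card_cubics by (auto simp: card_image)
  have A3V: "set_mset M \<subseteq> ?V \<and> size M = 3 \<and> (\<forall>v\<in>#M. ?val (M - {#v#}) \<in> W)" if MA3: "M \<in> ?A3" for M
  proof -
    obtain a b c where abc: "(a, b, c) \<in> cubics" "M = \<mu> (a, b, c)" using MA3 by auto
    note C = cubics_W[OF abc(1)]
    have MV: "set_mset M \<subseteq> ?V" using C(4) XY Z(3) abc(2) by (auto simp: \<mu>_def split: if_splits)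
    have val: "?val (\<mu> (a, b, c)) = a * (3 * m + 2) + b * (3 * m + 3) + c * (4 * m - 1)"
      if "0 < c \<longrightarrow> 4 \<le> s" for a b c
      using XY Z(3) that by (cases "c = 0") (simp_all add: \<mu>_def)
    have "?val (M - {#v#}) \<in> W" if v: "v \<in># M" for v
    proof -
      consider "v = X" "0 < a" | "v = Y" "0 < b" | "v = Z" "0 < c"
        using v abc(2) by (auto simp: \<mu>_def split: if_splits)
      then show ?thesis
      proof cases
        case 1
        then have eq: "M - {#v#} = \<mu> (a - 1, b, c)"
          using abc(2) by (cases a) (auto simp: \<mu>_def)
        show ?thesis unfolding eq using C(1)[OF 1(2)] C(4) by (subst val) auto
      next
        case 2
        then have eq: "M - {#v#} = \<mu> (a, b - 1, c)"
          using abc(2) by (cases b) (auto simp: \<mu>_def)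
        show ?thesis unfolding eq using C(2)[OF 2(2)] C(4) by (subst val) auto
      next
        case 3
        then have eq: "M - {#v#} = \<mu> (a, b, c - 1)"
          using abc(2) by (cases c) (auto simp: \<mu>_def)
        show ?thesis unfolding eq using C(3)[OF 3(2)] C(4) by (subst val) auto
      qed
    qed
    moreover have "size M = 3" using C(5) abc(2) by (simp add: \<mu>_def)
    ultimately show ?thesis using MV by blast
  qed
  have "card (?A2 \<union> ?A3) \<le> rho \<Gamma>"
  proof (rule card_isolated_multisets_le_rho[OF corners(1)])
    show "finite (?A2 \<union> ?A3)" using A2 A3 by simp
    fix M assume M: "M \<in> ?A2 \<union> ?A3"
    show MV: "set_mset M \<subseteq> ?V" using M A3V by blast
    have size: "2 \<le> size M" using M A3V[of M] by auto
    \<comment> \<open>A facet of a quadratic monomial is a single generator, a facet of a chosen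
      cubic has its value in \<open>W\<close>; both factor uniquely.\<close>
    show "a = count (M - {#v#})"
      if v: "v \<in># M" and a: "a \<in> nvecs (m - s)" "deg a = deg (count (M - {#v#}))" for v a
    proof -
      have sub: "set_mset (M - {#v#}) \<subseteq> {..<m - s}" using MV by (auto dest: in_diffD)
      show ?thesis
      proof (cases "M \<in> ?A2")
        case True
        then obtain p where p: "M - {#v#} = {#p#}"
          using v size_1_singleton_mset[of "M - {#v#}"] by (auto simp: size_Diff_singleton)
        have pk: "p < m - s" using sub p by simp
        have "count {#p#} = unit_vec p" by (auto simp: unit_vec_def)
        then show ?thesis
          using p a pk gen_unique_factorization[OF a(1) _ pk] deg_unit_vec[OF pk] by simp
      next
        case False
        obtain N where N: "a = count N" "set_mset N \<subseteq> {..<m - s}" using nvecs_count[OF a(1)] .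
        have "?val (M - {#v#}) \<in> W" using A3V[of M] M False v by blast
        then have "N = M - {#v#}"
          using a(2) N sub by (intro W_unique_factorization) (simp_all add: deg_count)
        then show ?thesis using N by simp
      qed
    qed
    have dM: "deg (count M) = ?val M" using MV V by (simp add: deg_count)
    \<comment> \<open>A factorization of an element of \<open>W\<close> has exactly two factors, so
      cubics are excluded by their size.\<close>
    have notW: "?val M \<notin> W"
    proof (cases "M \<in> ?A2")
      case False
      then have "size M = 3" using M A3V[of M] by blast
      then show ?thesis using W_factorization[OF V[OF MV]] by (metis size_add_mset size_empty numeral_3_eq_3 n_not_Suc_n)
    qed auto
    obtain p N where pN: "M = add_mset p N" "N \<noteq> {#}"
      using size by (cases M) fastforce+
    have pk: "p < m - s" using MV pN by simp
    have sum: "?val M = gen \<Gamma> p + deg (count N)" using pN MV V by (simp add: deg_count)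
    have "gen \<Gamma> p \<in> \<Gamma>" "gen \<Gamma> p \<noteq> 0" using gen_irreducible[OF pk] by (auto simp: irreducibles_def)
    moreover have "deg (count N) \<noteq> 0"
    proof
      assume "deg (count N) = 0"
      moreover have "count N \<in> nvecs (m - s)" using count_nvecs pN MV by auto
      ultimately have "count N = (\<lambda>_. 0)" using deg_eq_0 by blast
      then show False using pN by (metis count_empty multiset_eqI)
    qed
    ultimately have "?val M \<notin> irreducibles \<Gamma>" "?val M \<noteq> 0"
      using sum deg_mem[of "count N"] unfolding irreducibles_def by auto
    then show "\<exists>n\<in>\<Gamma>. deg (count M) = n + Defs.mult \<Gamma>"
      using deg_redundant[of "?val M"] notW deg_mem[of "count M"] dM mult_eq by simp
  qed
  moreover have "?A2 \<inter> ?A3 = {}" using A3V by fastforce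
  ultimately have "card ?A2 + card ?A3 \<le> rho \<Gamma>"
    using A2(2) A3(2) by (simp add: card_Un_disjoint)
  then have "((m - s) choose 2) + growth s \<le> rho \<Gamma> + s" using A2(1) A3(1) by linarith
  moreover obtain X where "rho \<Gamma> = card X" "finite X" "minimal_generating X" "card X \<le> card corners"
    by (rule rho_witness[OF corners(1)])
  ultimately show ?thesis using corners(2) by linarith
qed

end

theorem theorem3p3:
  fixes e m :: nat
  assumes "3 \<le> e" and "e < m" and "m - e \<le> 6"
  shows "max_rho e m = macaulay_bound e m"
proof -
  \<comment> \<open>The number of residues modulo \<open>m\<close> left over by 0 and the
    \<open>e\<close> other generators in the extremal case; also the \<open>s\<close> of
    \<open>macaulay_bound\<close>, whose index is 2.\<close>
  define s where "s = m - (e + 1)"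
  have sm: "m = e + 1 + s" "s \<le> 5" using assms by (auto simp: s_def)
  let ?R = "{rho \<Gamma> | \<Gamma>. numerical_monoid \<Gamma> \<and> edim \<Gamma> = e + 1 \<and> Defs.mult \<Gamma> = m}"
  note B = macaulay_bound_eq[OF assms(1) sm]
  have le: "r \<le> macaulay_bound e m" if r: "r \<in> ?R" for r
  proof -
    obtain \<Gamma> where \<Gamma>: "numerical_monoid \<Gamma>" "edim \<Gamma> = e + 1" "Defs.mult \<Gamma> = m" "r = rho \<Gamma>"
      using r by auto
    then have sub: "add_submonoid \<Gamma>" by (simp add: numerical_monoid_def)
    then have card: "card (irreducibles \<Gamma>) = e + 1"
      using \<Gamma>(2) min_gens_eq_irreducibles by (simp add: edim_def)
    interpret generated_monoid \<Gamma> "e + 1"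
      by standard (use sub card card.infinite in fastforce)+
    have "finite corners" "card corners + s \<le> ((e + 1) choose 2) + growth s"
      using corners_bound[of s] \<Gamma>(3) sm assms by auto
    then show ?thesis using rho_witness \<Gamma>(4) B by (metis add_le_cancel_right le_trans)
  qed
  interpret extremal_monoid m s using assms sm by unfold_locales auto
  have ms: "m - s = e + 1" using sm(1) by simp
  have "rho \<Gamma> = macaulay_bound e m" using rho_eq B unfolding ms by simp
  then have mem: "macaulay_bound e m \<in> ?R"
    using numerical edim_eq mult_eq ms by (auto intro!: exI[of _ \<Gamma>])
  have "finite ?R" using le by (meson finite_nat_set_iff_bounded_le)
  then show ?thesis
    unfolding max_rho_def using mem le by (intro Max_eqI) auto
qed

end
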